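(* Let $n\ge 1$ be an integer, let $\alpha\in[0,1)$ and $\beta\in(-1,1)$ with $\alpha\beta=0$, and let $1<p<1+\frac{2}{n-\alpha}$. Put $$B=\left(\int_0^{\infty}e^{-\int_0^t(1+s)^{-\beta}\,ds}\,dt\right)^{-1},\qquad \kappa=\frac{2(1+\beta)}{2-\alpha}\left(\frac{1}{p-1}-\frac{n-\alpha}{2}\right).$$ Assume that the (real-valued) initial data $(u_0,u_1)\in H^1(\mathbf{R}^n)\times L^2(\mathbf{R}^n)$ satisfy $$\langle x\rangle^{-\alpha}Bu_0+u_1\in L^1(\mathbf{R}^n)\quad\text{and}\quad \int_{\mathbf{R}^n}\left(\langle x\rangle^{-\alpha}Bu_0(x)+u_1(x)\right)dx>0.$$ For $\varepsilon>0$, let $T_\varepsilon$ be the lifespan (defined in the context) of the local solution of $$u_{tt}-\Delta u+\langle x\rangle^{-\alpha}(1+t)^{-\beta}u_t=|u|^p,\qquad (u,u_t)(0,x)=\varepsilon(u_0,u_1)(x).$$ Then there exists a constant $C>0$ depending only on $n,p,\alpha,\beta$ and $(u_0,u_1)$ such that for every $\varepsilon\in(0,1]$ $$T_{\varepsilon}\le C\begin{cases} \varepsilon^{-1/\kappa}&\text{if } 1+\frac{\alpha}{n-\alpha}<p<1+\frac{2}{n-\alpha},\\ \varepsilon^{-(p-1)}\left(\log(\varepsilon^{-1})\right)^{p-1}&\text{if } \alpha>0,\ p=1+\frac{\alpha}{n-\alpha},\\ \varepsilon^{-(p-1)}&\text{if } \alpha>0,\ 1<p<1+\frac{\alpha}{n-\alpha}.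 \end{cases}$$
   Context: Notation: $\langle x\rangle=\sqrt{1+|x|^2}$ for $x\in\mathbf{R}^n$; $\Phi(t,x)=\langle x\rangle^{-\alpha}(1+t)^{-\beta}$; $H^1(\mathbf{R}^n)$ is the usual Sobolev space. The unknown $u=u(t,x)$ is real-valued. Consider the Cauchy problem $$u_{tt}-\Delta u+\Phi(t,x)u_t=|u|^p,\quad (t,x)\in[0,\infty)\times\mathbf{R}^n,\qquad (u,u_t)(0,x)=\varepsilon(u_0,u_1)(x),\quad x\in\mathbf{R}^n. \quad (\ast)$$ Definition of solution: for $T\in(0,\infty]$ let $X(T)=C([0,T);H^1(\mathbf{R}^n))\cap C^1([0,T);L^2(\mathbf{R}^n))$. A function $u\in X(T)$ is called a solution of $(\ast)$ on the interval $[0,T)$ if $$\int_{[0,T)\times\mathbf{R}^n}u(t,x)\left(\partial_t^2\psi(t,x)-\Delta\psi(t,x)-\partial_t(\Phi(t,x)\psi(t,x))\right)dx\,dt$$ $$=\varepsilon\int_{\mathbf{R}^n}\left\{(\Phi(0,x)u_0(x)+u_1(x))\psi(0,x)-u_0(x)\partial_t\psi(0,x)\right\}dx+\int_{[0,T)\times\mathbf{R}^n}|u(t,x)|^p\psi(t,x)\,dx\,dt$$ holds for every $\psi\in C_0^\infty([0,T)\times\mathbf{R}^n)$ (smooth functions with compact support in $[0,T)\times\mathbf{R}^n$; $\psi$ need not vanish at $t=0$). Definition of lifespan: $$T_\varepsilon:=\sup\{\,T\in(0,\infty] : \text{there exists a unique solution } u\in X(T) \text{ of } (\ast)\,\}.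$$
   Formalization: In the critical case p=1+α/(n−α) the stated bound vanishes at ε=1, although T_1>0 by local existence. It is proved instead that for every ε_0<1 there is C, depending also on ε_0, with the stated bound for ε in (0,ε_0] and T_ε≤C for ε in (ε_0,1]. *)

theory Defs
  imports "HOL-Analysis.Analysis"
begin

section \<open>Smooth functions and test functions\<close>

definition dir_deriv :: "'a::euclidean_space \<Rightarrow> ('a \<Rightarrow> real) \<Rightarrow> 'a \<Rightarrow> real" where
  "dir_deriv v f = (\<lambda>x. frechet_derivative f (at x) v)"

primrec Ck :: "nat \<Rightarrow> ('a::euclidean_space \<Rightarrow> real) \<Rightarrow> bool" where
  "Ck 0 f \<longleftrightarrow> continuous_on UNIV f"
| "Ck (Suc k) f \<longleftrightarrow> (\<forall>x. f differentiable (at x)) \<and> (\<forall>b\<in>Basis. Ck k (dir_deriv b f))"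

definition smooth :: "('a::euclidean_space \<Rightarrow> real) \<Rightarrow> bool" where
  "smooth f \<longleftrightarrow> (\<forall>k. Ck k f)"

definition test_fun :: "('a::euclidean_space \<Rightarrow> real) \<Rightarrow> bool" where
  "test_fun \<phi> \<longleftrightarrow> smooth \<phi> \<and> compact (closure {x. \<phi> x \<noteq> 0})"

definition time_interval :: "ennreal \<Rightarrow> real set" where
  "time_interval T = {t. 0 \<le> t \<and> ennreal t < T}"

definition strip :: "ennreal \<Rightarrow> (real \<times> (real^'n)) set" where
  "strip T = time_interval T \<times> UNIV"

text \<open>
  Test functions on \<open>[0,T) \<times> R\<^sup>n\<close>. They need not vanish at \<open>t = 0\<close>. Smoothness up to
  \<open>t = 0\<close> means being the restriction of a smooth function on \<open>R \<times> R\<^sup>n\<close>; only the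
  values on \<open>[0,T) \<times> R\<^sup>n\<close> are required to have compact support there, the extension to
  negative times is arbitrary and enters none of the integrals below.
\<close>

definition strip_test_fun :: "ennreal \<Rightarrow> (real \<times> (real^'n) \<Rightarrow> real) \<Rightarrow> bool" where
  "strip_test_fun T \<psi> \<longleftrightarrow> smooth \<psi> \<and>
     (\<exists>K. compact K \<and> K \<subseteq> strip T \<and> (\<forall>z\<in>strip T - K. \<psi> z = 0))"

abbreviation dt :: "(real \<times> (real^'n) \<Rightarrow> real) \<Rightarrow> real \<times> (real^'n) \<Rightarrow> real" where
  "dt \<equiv> dir_deriv (1, 0)"

definition laplace_x :: "(real \<times> (real^'n) \<Rightarrow> real) \<Rightarrow> real \<times> (real^'n) \<Rightarrow> real" where
  "laplace_x \<psi> = (\<lambda>z. \<Sum>i\<in>UNIV. dir_deriv (0, axis i 1) (dir_deriv (0, axis i 1) \<psi>) z)"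

section \<open>The spaces $L^2$ and $H^1$\<close>

text \<open>
  Elements of \<open>L\<^sup>2\<close> and \<open>H\<^sup>1\<close> are given by representatives; identification
  up to null sets is made explicit where it matters (in the uniqueness of solutions).
\<close>

definition L2 :: "((real^'n) \<Rightarrow> real) set" where
  "L2 = {f. f \<in> borel_measurable lebesgue \<and> integrable lebesgue (\<lambda>x. (f x)\<^sup>2)}"

definition L2_norm :: "((real^'n) \<Rightarrow> real) \<Rightarrow> real" where
  "L2_norm f = sqrt (LINT x|lebesgue. (f x)\<^sup>2)"

definition is_weak_partial :: "'n \<Rightarrow> ((real^'n) \<Rightarrow> real) \<Rightarrow> ((real^'n) \<Rightarrow> real) \<Rightarrow> bool" where
  "is_weak_partial i f g \<longleftrightarrow>
     (\<forall>\<phi>. test_fun \<phi> \<longrightarrow>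
        (LINT x|lebesgue. f x * dir_deriv (axis i 1) \<phi> x) = - (LINT x|lebesgue. g x * \<phi> x))"

definition H1 :: "((real^'n) \<Rightarrow> real) set" where
  "H1 = {f \<in> L2. \<forall>i. \<exists>g\<in>L2. is_weak_partial i f g}"

text \<open>Weak derivatives are unique up to null sets, so the choice does not affect the norm.\<close>

definition weak_partial :: "'n \<Rightarrow> ((real^'n) \<Rightarrow> real) \<Rightarrow> (real^'n) \<Rightarrow> real" where
  "weak_partial i f = (SOME g. g \<in> L2 \<and> is_weak_partial i f g)"

definition H1_norm :: "((real^'n) \<Rightarrow> real) \<Rightarrow> real" where
  "H1_norm f = sqrt ((L2_norm f)\<^sup>2 + (\<Sum>i\<in>UNIV. (L2_norm (weak_partial i f))\<^sup>2))"

section \<open>The solution space\<close>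

definition C_H1 :: "real set \<Rightarrow> (real \<Rightarrow> (real^'n) \<Rightarrow> real) \<Rightarrow> bool" where
  "C_H1 I u \<longleftrightarrow> (\<forall>t\<in>I. u t \<in> H1) \<and>
     (\<forall>t\<in>I. ((\<lambda>s. H1_norm (\<lambda>x. u s x - u t x)) \<longlongrightarrow> 0) (at t within I))"

definition C_L2 :: "real set \<Rightarrow> (real \<Rightarrow> (real^'n) \<Rightarrow> real) \<Rightarrow> bool" where
  "C_L2 I u \<longleftrightarrow> (\<forall>t\<in>I. u t \<in> L2) \<and>
     (\<forall>t\<in>I. ((\<lambda>s. L2_norm (\<lambda>x. u s x - u t x)) \<longlongrightarrow> 0) (at t within I))"

definition C1_L2 :: "real set \<Rightarrow> (real \<Rightarrow> (real^'n) \<Rightarrow> real) \<Rightarrow> bool" where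
  "C1_L2 I u \<longleftrightarrow> C_L2 I u \<and>
     (\<exists>v. C_L2 I v \<and>
        (\<forall>t\<in>I. ((\<lambda>s. L2_norm (\<lambda>x. (u s x - u t x) / (s - t) - v t x)) \<longlongrightarrow> 0) (at t within I)))"

text \<open>
  Every curve in \<open>C([0,T); L\<^sup>2)\<close> has a representative that is measurable in
  \<open>(t,x)\<close>. Requiring such a representative excludes no curve; without it, the space-time
  integrals in the weak formulation would be meaningless.
\<close>

definition X_space :: "ennreal \<Rightarrow> (real \<Rightarrow> (real^'n) \<Rightarrow> real) set" where
  "X_space T = {u. C_H1 (time_interval T) u \<and> C1_L2 (time_interval T) u \<and>
     set_borel_measurable lebesgue (strip T) (\<lambda>(t, x). u t x)}"

section \<open>Weak solutions and lifespan\<close>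

definition japanese :: "(real^'n) \<Rightarrow> real" where
  "japanese x = sqrt (1 + (norm x)\<^sup>2)"

definition damping :: "real \<Rightarrow> real \<Rightarrow> real \<times> (real^'n) \<Rightarrow> real" where
  "damping \<alpha> \<beta> = (\<lambda>(t, x). japanese x powr (- \<alpha>) * (1 + t) powr (- \<beta>))"

text \<open>
  The two integrability clauses say that the space-time integrals exist (the Bochner integral of
  a non-integrable function is 0). In the subcritical range they follow from \<open>u \<in> X(T)\<close>
  and the Sobolev embedding.
\<close>

definition is_solution ::
  "real \<Rightarrow> real \<Rightarrow> real \<Rightarrow> real \<Rightarrow> ((real^'n) \<Rightarrow> real) \<Rightarrow> ((real^'n) \<Rightarrow> real) \<Rightarrow> ennreal
    \<Rightarrow> (real \<Rightarrow> (real^'n) \<Rightarrow> real) \<Rightarrow> bool" where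
  "is_solution \<alpha> \<beta> p \<epsilon> u0 u1 T u \<longleftrightarrow> u \<in> X_space T \<and>
     (\<forall>\<psi>. strip_test_fun T \<psi> \<longrightarrow>
        (let lin = (\<lambda>(t, x). u t x *
               (dt (dt \<psi>) (t, x) - laplace_x \<psi> (t, x) - dt (\<lambda>z. damping \<alpha> \<beta> z * \<psi> z) (t, x)));
             nonlin = (\<lambda>(t, x). \<bar>u t x\<bar> powr p * \<psi> (t, x))
         in set_integrable lebesgue (strip T) lin \<and>
            set_integrable lebesgue (strip T) nonlin \<and>
            (LINT z:strip T|lebesgue. lin z) =
              \<epsilon> * (LINT x|lebesgue. (damping \<alpha> \<beta> (0, x) * u0 x + u1 x) * \<psi> (0, x)
                     - u0 x * dt \<psi> (0, x))
              + (LINT z:strip T|lebesgue. nonlin z)))"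

definition lifespan ::
  "real \<Rightarrow> real \<Rightarrow> real \<Rightarrow> ((real^'n) \<Rightarrow> real) \<Rightarrow> ((real^'n) \<Rightarrow> real) \<Rightarrow> real \<Rightarrow> ennreal" where
  "lifespan \<alpha> \<beta> p u0 u1 \<epsilon> = Sup {T. 0 < T \<and>
     (\<exists>u. is_solution \<alpha> \<beta> p \<epsilon> u0 u1 T u \<and>
        (\<forall>v. is_solution \<alpha> \<beta> p \<epsilon> u0 u1 T v \<longrightarrow>
           (\<forall>t\<in>time_interval T. AE x in lebesgue. v t x = u t x)))}"

section \<open>The constants in the estimate\<close>

definition B_const :: "real \<Rightarrow> real" where
  "B_const \<beta> = inverse (LBINT t:{0..}. exp (- (LBINT s:{0..t}. (1 + s) powr (- \<beta>))))"

definition kappa :: "nat \<Rightarrow> real \<Rightarrow> real \<Rightarrow> real \<Rightarrow> real" where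
  "kappa n \<alpha> \<beta> p = 2 * (1 + \<beta>) / (2 - \<alpha>) * (1 / (p - 1) - (real n - \<alpha>) / 2)"

end

theory Submission
  imports Defs "HOL-Computational_Algebra.Polynomial" "HOL-Real_Asymp.Real_Asymp"
begin

text \<open>
  Proof idea. Multiplying the equation by the solution \<open>g\<close> of \<open>g' = (1 + t) powr (- \<beta>) * g - 1\<close>,
  \<open>g 0 = 1 / B\<close>, puts the damping into divergence form; \<open>g\<close> is comparable to
  \<open>(1 + t) powr \<beta>\<close>, and it is constant if \<open>\<beta> = 0\<close>. The weak formulation is tested with \<open>g\<close> times
  a cutoff at time \<open>R\<close> and radius \<open>L\<close>, where \<open>L powr (2 - \<alpha>) = R powr (1 + \<beta>)\<close> is the scaling under
  which damping and Laplacian balance. Young's inequality absorbs the terms linear in \<open>u\<close> into the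
  nonlinearity and leaves \<open>\<epsilon> \<lesssim> R powr (- \<kappa>) + R powr (- (1 + \<beta>) / (p - 1)) * J\<close>, where \<open>J\<close> is the
  integral of \<open>japanese x powr (- \<alpha> * p / (p - 1))\<close> over the ball of radius \<open>L\<close>. The three regimes of
  the theorem are those of power growth, logarithmic growth and boundedness of \<open>J\<close>.
\<close>

section \<open>Calculus of smooth functions\<close>

text \<open>For \<open>g\<close> times a time cutoff \<open>e\<close>, the adjoint operator produces
  the term \<open>(1 - j) * g'' * e\<close> with \<open>j = japanese x powr (- \<alpha>)\<close>. No
  derivative falls on the cutoff there, so enlarging \<open>R\<close> would not make it small. It
  vanishes if \<open>j = 1\<close>, that is for \<alpha> = 0, or if \<open>g\<close> is constant,
  that is for \<beta> = 0; this is the role of \<open>\<alpha> * \<beta> = 0\<close>. All solutions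
  of the equation for \<open>g\<close> differ by multiples of the exponential of the integrated
  damping, which outgrows \<open>(1 + t) powr \<beta>\<close>. Hence \<open>1 / B\<close> is the
  only initial value compatible with the stated size of \<open>g\<close>. It is also why
  \<open>B\<close> occurs in the condition on the data: \<open>g 0 * B = 1\<close> turns the terms
  at time 0 into \<open>g 0\<close> times the assumed combination of \<open>u0\<close> and
  \<open>u1\<close>. The obstacle to the absorption lies at the edge of the support, where the
  derivatives of the cutoff must be controlled by its power \<open>1 / p\<close>. The cut-off
  integral of the data is known to be positive only for large \<open>L\<close>, so the inequality
  starts at some \<open>R0\<close>; since \<epsilon> is at most 1, \<open>R0\<close> can be put into
  the final constant.\<close>

lemma dir_deriv_eq: "(f has_derivative f') (at x) \<Longrightarrow> dir_deriv v f x = f' v"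
  unfolding dir_deriv_def by (metis frechet_derivative_at)

lemma frechet_derivative_worksD:
  "f differentiable F \<Longrightarrow> (f has_derivative frechet_derivative f F) F"
  by (simp add: frechet_derivative_works)

lemma Ck_Suc_imp_continuous: "Ck (Suc k) f \<Longrightarrow> continuous_on UNIV f"
  by (auto simp: continuous_on_eq_continuous_at differentiable_imp_continuous_within)

lemma Ck_SucD: "Ck (Suc k) f \<Longrightarrow> Ck k f"
proof (induction k arbitrary: f)
  case 0
  then show ?case using Ck_Suc_imp_continuous by (metis Ck.simps(1))
next
  case (Suc k)
  then show ?case by (metis Ck.simps(2))
qed

lemma Ck_const: "Ck k (\<lambda>x::'a::euclidean_space. c)"
proof (induction k arbitrary: c)
  case (Suc k)
  have "dir_deriv b (\<lambda>x::'a. c) = (\<lambda>x. 0)" for b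
    by (rule ext, rule dir_deriv_eq) (auto intro!: derivative_eq_intros)
  with Suc show ?case by simp
qed simp

lemma Ck_bounded_linear: "bounded_linear f \<Longrightarrow> Ck k f"
proof (cases k)
  case 0
  assume "bounded_linear f"
  then show ?thesis by (simp add: 0 linear_continuous_on)
next
  case (Suc k)
  assume f: "bounded_linear f"
  have "dir_deriv b f = (\<lambda>x. f b)" for b
    by (rule ext, rule dir_deriv_eq) (rule bounded_linear_imp_has_derivative[OF f])
  with f show ?thesis
    by (auto simp: Suc Ck_const bounded_linear_imp_differentiable)
qed

lemma Ck_add: "Ck k f \<Longrightarrow> Ck k g \<Longrightarrow> Ck k (\<lambda>x. f x + g x)"
proof (induction k arbitrary: f g)
  case 0
  then show ?case by (auto intro: continuous_on_add)
next
  case (Suc k)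
  have "dir_deriv b (\<lambda>x. f x + g x) = (\<lambda>x. dir_deriv b f x + dir_deriv b g x)" for b
  proof
    fix x
    have "((\<lambda>x. f x + g x) has_derivative
        (\<lambda>h. frechet_derivative f (at x) h + frechet_derivative g (at x) h)) (at x)"
      using Suc.prems by (intro has_derivative_add frechet_derivative_worksD) auto
    from dir_deriv_eq[OF this]
    show "dir_deriv b (\<lambda>x. f x + g x) x = dir_deriv b f x + dir_deriv b g x"
      by (simp add: dir_deriv_def)
  qed
  with Suc show ?case by (auto intro: differentiable_add)
qed

lemma dir_deriv_mult:
  assumes "f differentiable at x" "g differentiable at x"
  shows "dir_deriv b (\<lambda>x. f x * g x) x = dir_deriv b f x * g x + f x * dir_deriv b g x"
proof -
  have "((\<lambda>x. f x * g x) has_derivative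
      (\<lambda>h. f x * frechet_derivative g (at x) h + frechet_derivative f (at x) h * g x)) (at x)"
    using assms by (intro has_derivative_mult) (simp_all add: frechet_derivative_worksD)
  from dir_deriv_eq[OF this] show ?thesis
    by (simp add: dir_deriv_def)
qed

lemma Ck_mult: "Ck k f \<Longrightarrow> Ck k g \<Longrightarrow> Ck k (\<lambda>x. f x * g x)"
proof (induction k arbitrary: f g)
  case 0
  then show ?case by (auto intro: continuous_on_mult)
next
  case (Suc k)
  have eq: "dir_deriv b (\<lambda>x. f x * g x) = (\<lambda>x. dir_deriv b f x * g x + f x * dir_deriv b g x)" for b
    using Suc.prems by (auto simp: dir_deriv_mult)
  have "Ck k f" "Ck k g" using Suc.prems Ck_SucD by blast+
  with Suc show ?case by (auto simp: eq intro!: Ck_add)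
qed

lemma DERIV_dir_deriv:
  assumes "F differentiable at x"
  shows "(F has_real_derivative dir_deriv 1 F x) (at x)"
  using assms frechet_derivative_works[of F "at x"]
  by (metis DERIV_deriv_iff_real_differentiable dir_deriv_eq has_field_derivative_imp_has_derivative mult.right_neutral)

lemma dir_deriv_eq_DERIV:
  assumes "(F has_real_derivative D) (at x)"
  shows "dir_deriv 1 F x = D"
  using assms DERIV_dir_deriv DERIV_unique real_differentiable_def by blast

lemma dir_deriv_compose:
  assumes "(F has_real_derivative D) (at (f x))" "f differentiable at x"
  shows "dir_deriv b (\<lambda>x. F (f x)) x = D * dir_deriv b f x"
proof -
  have "((\<lambda>x. F (f x)) has_derivative (\<lambda>h. D * frechet_derivative f (at x) h)) (at x)"
    using has_derivative_compose[OF frechet_derivative_worksD[OF assms(2)]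
        has_field_derivative_imp_has_derivative[OF assms(1)]] .
  from dir_deriv_eq[OF this] show ?thesis by (simp add: dir_deriv_def)
qed

lemma differentiable_compose_real:
  fixes F :: "real \<Rightarrow> real"
  assumes "F differentiable at (f x)" "f differentiable at x"
  shows "(\<lambda>x. F (f x)) differentiable at x"
  using differentiable_chain_at[of f x F] assms by (simp add: o_def)

lemma Ck_compose:
  fixes F :: "real \<Rightarrow> real"
  shows "Ck k F \<Longrightarrow> Ck k f \<Longrightarrow> Ck k (\<lambda>x. F (f x))"
proof (induction k arbitrary: F f)
  case 0
  then show ?case by (auto intro: continuous_on_compose2)
next
  case (Suc k)
  have eq: "dir_deriv b (\<lambda>x. F (f x)) = (\<lambda>x. dir_deriv 1 F (f x) * dir_deriv b f x)" for b
    using dir_deriv_compose[OF DERIV_dir_deriv, of F f _ b] Suc.prems by fastforce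
  have "Ck k F" "Ck k f" using Suc.prems Ck_SucD by blast+
  with Suc have "Ck k (dir_deriv b (\<lambda>x. F (f x)))" if "b \<in> Basis" for b
    unfolding eq using that by (intro Ck_mult) simp_all
  moreover have "(\<lambda>x. F (f x)) differentiable at x" for x
    by (rule differentiable_compose_real[of F f]) (use Suc.prems in simp_all)
  ultimately show ?case by simp
qed

text \<open>Differentiation lowers the exponent, hence \<open>a\<close> is generalised in the
  induction.\<close>

lemma Ck_powr:
  assumes pos: "\<And>x. q x > 0"
  shows "Ck k q \<Longrightarrow> Ck k (\<lambda>x. q x powr a)"
proof (induction k arbitrary: a)
  case 0
  have "q x \<noteq> 0" for x using pos[of x] by simp
  with 0 show ?case by (simp add: continuous_on_powr)
next
  case (Suc k)
  have D: "((\<lambda>y. y powr a) has_real_derivative a * q x powr (a - 1)) (at (q x))" for x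
    by (rule has_real_derivative_powr[OF pos])
  have eq: "dir_deriv b (\<lambda>x. q x powr a) = (\<lambda>x. (a * q x powr (a - 1)) * dir_deriv b q x)" for b
    by (rule ext, rule dir_deriv_compose[of "\<lambda>y. y powr a" _ q, OF D]) (use Suc.prems in simp)
  have Ck: "Ck k q" by (rule Ck_SucD[OF Suc.prems])
  have d: "(\<lambda>x. q x powr a) differentiable at x" for x
  proof (rule differentiable_compose_real[of "\<lambda>y. y powr a" q])
    show "(\<lambda>y. y powr a) differentiable at (q x)"
      using D real_differentiable_def by blast
  qed (use Suc.prems in simp)
  have "Ck k (dir_deriv b (\<lambda>x. q x powr a))" if "b \<in> Basis" for b
  proof -
    have "Ck k (dir_deriv b q)" using Suc.prems that by simp
    then show ?thesis
      unfolding eq by (intro Ck_mult Ck_const Suc.IH Ck)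
  qed
  with d show ?case by (metis Ck.simps(2))
qed

section \<open>Closure properties of smooth functions\<close>

lemma smooth_const: "smooth (\<lambda>x. c)"
  by (simp add: smooth_def Ck_const)

lemma smooth_bounded_linear: "bounded_linear f \<Longrightarrow> smooth f"
  by (simp add: smooth_def Ck_bounded_linear)

lemma smooth_add: "smooth f \<Longrightarrow> smooth g \<Longrightarrow> smooth (\<lambda>x. f x + g x)"
  by (simp add: smooth_def Ck_add)

lemma smooth_mult: "smooth f \<Longrightarrow> smooth g \<Longrightarrow> smooth (\<lambda>x. f x * g x)"
  by (simp add: smooth_def Ck_mult)

lemma smooth_compose:
  fixes F :: "real \<Rightarrow> real"
  shows "smooth F \<Longrightarrow> smooth f \<Longrightarrow> smooth (\<lambda>x. F (f x))"
  by (simp add: smooth_def Ck_compose)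

lemma smooth_powr: "(\<And>x. q x > 0) \<Longrightarrow> smooth q \<Longrightarrow> smooth (\<lambda>x. q x powr a)"
  by (simp add: smooth_def Ck_powr)

lemma smooth_power: "smooth f \<Longrightarrow> smooth (\<lambda>x. f x ^ m)"
  by (induction m) (auto intro: smooth_const smooth_mult)

lemma smooth_imp_differentiable: "smooth f \<Longrightarrow> f differentiable at x"
  unfolding smooth_def by (metis Ck.simps(2))

lemma smooth_dir_deriv_Basis: "smooth f \<Longrightarrow> b \<in> Basis \<Longrightarrow> smooth (dir_deriv b f)"
  unfolding smooth_def by (metis Ck.simps(2))

lemma smooth_dir_deriv_1: "smooth F \<Longrightarrow> smooth (dir_deriv 1 F)" for F :: "real \<Rightarrow> real"
  by (rule smooth_dir_deriv_Basis) auto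

lemma smooth_imp_continuous_on: "smooth f \<Longrightarrow> continuous_on S f"
  unfolding smooth_def by (metis Ck.simps(1) continuous_on_subset subset_UNIV)

lemma smooth_DERIV: "smooth F \<Longrightarrow> (F has_real_derivative dir_deriv 1 F x) (at x)"
  by (simp add: DERIV_dir_deriv smooth_imp_differentiable)

text \<open>A class closed under differentiation contains only smooth functions. This yields
  smoothness of the flat functions without a formula for their higher derivatives.\<close>

lemma smooth_real_coinduct:
  fixes f :: "real \<Rightarrow> real"
  assumes "P f" and step: "\<And>f. P f \<Longrightarrow> \<exists>f'. P f' \<and> (\<forall>x. (f has_real_derivative f' x) (at x))"
  shows "smooth f"
proof -
  have "P f \<Longrightarrow> Ck k f" for k f
  proof (induction k arbitrary: f)
    case 0
    then show ?case using step[OF 0]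
      by (auto simp: continuous_on_eq_continuous_at intro: DERIV_isCont)
  next
    case (Suc k)
    then obtain f' where f': "P f'" "\<And>x. (f has_real_derivative f' x) (at x)"
      using step by blast
    then have "dir_deriv 1 f = f'" by (auto intro: dir_deriv_eq_DERIV)
    with Suc f' show ?case by (auto simp: real_differentiable_def)
  qed
  with assms(1) show ?thesis by (simp add: smooth_def)
qed

text \<open>The partial derivatives are linear, so \<open>Ck_bounded_linear\<close> takes over after
  a single differentiation.\<close>

lemma smooth_inner_self: "smooth (\<lambda>x::'a::euclidean_space. x \<bullet> x)"
proof -
  have *: "((\<lambda>x::'a. x \<bullet> x) has_derivative (\<lambda>h. x \<bullet> h + h \<bullet> x)) (at x)" for x
    by (auto intro!: derivative_eq_intros)
  have "dir_deriv b (\<lambda>x::'a. x \<bullet> x) = (\<lambda>x. 2 * (x \<bullet> b))" for b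
    by (rule ext) (simp add: dir_deriv_eq[OF *] inner_commute)
  moreover have "bounded_linear (\<lambda>x::'a. 2 * (x \<bullet> b))" for b
    by (intro bounded_linear_intros)
  ultimately have "Ck (Suc k) (\<lambda>x::'a. x \<bullet> x)" for k
    using * by (auto simp: differentiable_def intro!: Ck_bounded_linear)
  then show ?thesis unfolding smooth_def by (blast intro: Ck_SucD)
qed

section \<open>Functions of one component of a product\<close>

lemma smooth_fst: "smooth F \<Longrightarrow> smooth (\<lambda>z::real \<times> 'a::euclidean_space. F (fst z))"
  by (rule smooth_compose) (auto intro!: smooth_bounded_linear bounded_linear_fst)

lemma dir_deriv_snd:
  assumes "f differentiable at (snd z)"
  shows "dir_deriv b (\<lambda>z::real \<times> 'a::euclidean_space. f (snd z)) z = dir_deriv (snd b) f (snd z)"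
proof -
  have "((\<lambda>z. f (snd z)) has_derivative (\<lambda>h. frechet_derivative f (at (snd z)) (snd h))) (at z)"
    by (rule has_derivative_compose[where f=snd and g=f])
      (auto intro!: derivative_eq_intros frechet_derivative_worksD assms)
  from dir_deriv_eq[OF this] show ?thesis by (simp add: dir_deriv_def)
qed

lemma dir_deriv_fst:
  assumes "(f has_real_derivative D) (at (fst z))"
  shows "dir_deriv b (\<lambda>z::real \<times> 'a::euclidean_space. f (fst z)) z = D * fst b"
proof -
  have "((\<lambda>z. f (fst z)) has_derivative (\<lambda>h. D * fst h)) (at z)"
    by (rule has_derivative_compose[where f=fst and g=f])
      (use assms in \<open>auto intro!: derivative_eq_intros simp: has_field_derivative_def\<close>)
  from dir_deriv_eq[OF this] show ?thesis by simp
qed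

lemma Ck_snd: "Ck k f \<Longrightarrow> Ck k (\<lambda>z::real \<times> 'a::euclidean_space. f (snd z))"
proof (induction k arbitrary: f)
  case 0
  then show ?case by (auto intro!: continuous_on_compose2[of UNIV f _ snd] continuous_intros)
next
  case (Suc k)
  have eq: "dir_deriv b (\<lambda>z::real \<times> 'a. f (snd z)) = (\<lambda>z. dir_deriv (snd b) f (snd z))" for b
    using Suc.prems by (auto intro!: dir_deriv_snd)
  \<comment> \<open>\<open>Ck\<close> controls only directions in \<open>Basis\<close>, but the
    basis vector \<open>(1, 0)\<close> projects to 0; the derivative in direction 0 is treated
    separately.\<close>
  have "Ck k (dir_deriv (snd b) f)" if "b \<in> Basis" for b :: "real \<times> 'a"
  proof (cases "snd b = 0")
    case True
    have "dir_deriv 0 f = (\<lambda>x. 0)"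
    proof
      fix x
      have "(f has_derivative frechet_derivative f (at x)) (at x)"
        using Suc.prems by (auto simp: frechet_derivative_worksD)
      then show "dir_deriv 0 f x = 0"
        unfolding dir_deriv_def by (metis has_derivative_bounded_linear linear_simps(3))
    qed
    with True show ?thesis by (simp add: Ck_const)
  next
    case False
    with that have "snd b \<in> Basis" by (auto simp: Basis_prod_def)
    then show ?thesis using Suc.prems by auto
  qed
  moreover have "(\<lambda>z::real \<times> 'a. f (snd z)) differentiable at z" for z
    using differentiable_chain_at[of snd z f] Suc.prems
    by (auto simp: o_def bounded_linear_imp_differentiable bounded_linear_snd)
  ultimately show ?case using Suc by (auto simp: eq)
qed

lemma smooth_snd: "smooth f \<Longrightarrow> smooth (\<lambda>z::real \<times> 'a::euclidean_space. f (snd z))"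
  by (simp add: smooth_def Ck_snd)

section \<open>A smooth cutoff\<close>

text \<open>For \<open>P = 1\<close> this is the classical flat function exp(-1/x) on the positive
  half-line. The polynomial factor makes the family closed under differentiation.\<close>

definition flat_fun :: "real poly \<Rightarrow> real \<Rightarrow> real" where
  "flat_fun P x = (if x \<le> 0 then 0 else poly P (inverse x) * exp (- inverse x))"

lemma poly_times_exp_tendsto_0: "((\<lambda>y. poly P y * exp (- y)) \<longlongrightarrow> (0::real)) at_top"
proof -
  have "((\<lambda>y::real. \<Sum>i\<le>degree P. coeff P i * (y ^ i / exp y)) \<longlongrightarrow> (\<Sum>i\<le>degree P. coeff P i * 0)) at_top"
    by (intro tendsto_intros tendsto_power_div_exp_0)
  then show ?thesis
    by (simp add: poly_altdef sum_distrib_right sum_divide_distrib exp_minus divide_inverse mult.assoc)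
qed

text \<open>The chain rule gives x^(-2) (P - P')(1/x) exp(-1/x) for x > 0, and x^(-2) is the
  monomial \<open>[:0, 0, 1:]\<close> evaluated at 1/x.\<close>

lemma flat_fun_DERIV:
  "(flat_fun P has_real_derivative flat_fun ([:0, 0, 1:] * (P - pderiv P)) x) (at x)"
proof (cases "x = 0")
  case True
  \<comment> \<open>The difference quotient at 0 has the same shape: division by \<open>h\<close>
    multiplies the polynomial by its variable.\<close>
  have "((\<lambda>h. poly ([:0, 1:] * P) (inverse h) * exp (- inverse h)) \<longlongrightarrow> 0) (at_right 0)"
    by (rule filterlim_compose[OF poly_times_exp_tendsto_0 filterlim_inverse_at_top_right])
  then have right: "((\<lambda>h. flat_fun P h / h) \<longlongrightarrow> 0) (at_right 0)"
    by (rule Lim_transform_eventually)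
      (auto simp: eventually_at_filter flat_fun_def field_simps)
  have left: "((\<lambda>h. flat_fun P h / h) \<longlongrightarrow> 0) (at_left 0)"
    by (rule Lim_transform_eventually[OF tendsto_const])
      (auto simp: eventually_at_filter flat_fun_def)
  from right left have "((\<lambda>h. flat_fun P h / h) \<longlongrightarrow> 0) (at 0)"
    by (simp add: filterlim_split_at)
  with True show ?thesis
    by (simp add: has_field_derivative_iff flat_fun_def)
next
  case False
  then consider "x < 0" | "x > 0" by linarith
  then show ?thesis
  proof cases
    case 1
    have "((\<lambda>x. 0) has_real_derivative 0) (at x)" by simp
    then have "(flat_fun P has_real_derivative 0) (at x)"
      by (rule has_field_derivative_transform_within_open[of _ _ _ "{..<0}"])
        (use 1 in \<open>auto simp: flat_fun_def\<close>)
    with 1 show ?thesis by (simp add: flat_fun_def)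
  next
    case 2
    have "((\<lambda>x. poly P (inverse x) * exp (- inverse x)) has_real_derivative
        flat_fun ([:0, 0, 1:] * (P - pderiv P)) x) (at x)"
      using 2
      by (auto intro!: derivative_eq_intros DERIV_chain2[OF poly_DERIV]
          simp: flat_fun_def algebra_simps power2_eq_square)
    then show ?thesis
      by (rule has_field_derivative_transform_within_open[of _ _ _ "{0<..}"])
        (use 2 in \<open>auto simp: flat_fun_def\<close>)
  qed
qed

lemma smooth_flat_fun: "smooth (flat_fun P)"
  by (rule smooth_real_coinduct[where P="\<lambda>f. f \<in> range flat_fun"])
    (use flat_fun_DERIV in blast)+

text \<open>The quotient e(1 - s) / (e(1 - s) + e(s - 1/2)), with e the flat function, has a
  positive denominator because 1 - s and s - 1/2 are never both nonpositive. Differences and the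
  quotient are written through sums, products and \<open>powr (-1)\<close>, for which closure rules
  are at hand.\<close>

lemma smooth_step_exists:
  obtains h :: "real \<Rightarrow> real"
  where "smooth h" "\<And>s. 0 \<le> h s" "\<And>s. h s \<le> 1"
    "\<And>s. s \<le> 1/2 \<Longrightarrow> h s = 1" "\<And>s. s \<ge> 1 \<Longrightarrow> h s = 0"
proof
  let ?e = "flat_fun 1"
  let ?d = "\<lambda>s. ?e (1 + (-1) * s) + ?e (s + (-1/2))"
  let ?h = "\<lambda>s. ?e (1 + (-1) * s) * ?d s powr (-1)"
  have e0: "?e x \<ge> 0" and epos: "x > 0 \<Longrightarrow> ?e x > 0" for x
    by (auto simp: flat_fun_def)
  have d: "?d s > 0" for s
    using e0[of "1 - s"] e0[of "s - 1/2"] epos[of "1 - s"] epos[of "s - 1/2"]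
    by (cases "s < 1") (auto intro: add_pos_nonneg add_nonneg_pos)
  have id: "smooth (\<lambda>s::real. s)"
    by (intro smooth_bounded_linear bounded_linear_ident)
  have sm: "smooth (\<lambda>s. ?e (1 + (-1) * s))" "smooth (\<lambda>s. ?e (s + (-1/2)))"
    by (intro smooth_compose[OF smooth_flat_fun] smooth_add smooth_mult smooth_const id)+
  show "smooth ?h"
    by (intro smooth_mult smooth_powr smooth_add sm) (rule d)
  fix s
  have eq: "?h s = ?e (1 - s) / ?d s"
    using d[of s] by (simp add: powr_minus field_simps)
  show "0 \<le> ?h s" "?h s \<le> 1"
    unfolding eq using d[of s] e0 by (auto simp: divide_simps)
  show "s \<le> 1/2 \<Longrightarrow> ?h s = 1"
    unfolding eq using d[of s] by (auto simp: flat_fun_def)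
  show "s \<ge> 1 \<Longrightarrow> ?h s = 0"
    by (auto simp: flat_fun_def)
qed

lemma dir_deriv_const_on_open:
  assumes "open S" "x \<in> S" "\<And>y. y \<in> S \<Longrightarrow> f y = c"
  shows "dir_deriv b f x = 0"
proof -
  have "((\<lambda>y. c) has_derivative (\<lambda>h. 0)) (at x)" by simp
  then have "(f has_derivative (\<lambda>h. 0)) (at x)"
    by (rule has_derivative_transform_within_open[OF _ assms(1,2)]) (simp add: assms(3))
  then show ?thesis by (rule dir_deriv_eq)
qed

lemma bounded_if_zero_outside_Icc:
  fixes f :: "real \<Rightarrow> real"
  assumes "continuous_on {a..b} f" "\<And>s. s < a \<Longrightarrow> f s = 0" "\<And>s. s > b \<Longrightarrow> f s = 0"
  obtains M where "M > 0" "\<And>s. \<bar>f s\<bar> \<le> M"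
proof -
  have "bounded (f ` {a..b})"
    by (intro compact_imp_bounded compact_continuous_image assms) simp
  then obtain M where M: "M > 0" "\<And>s. s \<in> {a..b} \<Longrightarrow> \<bar>f s\<bar> \<le> M"
    by (auto simp: bounded_pos)
  show ?thesis
  proof
    show "\<bar>f s\<bar> \<le> M" for s
      using M assms(2,3)[of s] by (cases "s < a"; cases "s > b") auto
  qed fact
qed

text \<open>Bounds of the derivatives by a constant would not do: Young's inequality pairs them with
  the power \<open>1 / p\<close> of the cutoff, which itself tends to 0 at the edge of the support.
  A sufficiently high power of a smooth step has the required bounds.\<close>

lemma cutoff_exists:
  fixes p :: real
  assumes p: "p > 1"
  obtains H :: "real \<Rightarrow> real" and C
  where "smooth H" "\<And>s. 0 \<le> H s" "\<And>s. H s \<le> 1" "C > 0"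
    "\<And>s. s \<le> 1/2 \<Longrightarrow> H s = 1" "\<And>s. s \<ge> 1 \<Longrightarrow> H s = 0"
    "\<And>s. s < 1/2 \<Longrightarrow> dir_deriv 1 H s = 0"
    "\<And>s. \<bar>dir_deriv 1 H s\<bar> \<le> C * H s powr (1 / p)"
    "\<And>s. \<bar>dir_deriv 1 (dir_deriv 1 H) s\<bar> \<le> C * H s powr (1 / p)"
proof -
  obtain h :: "real \<Rightarrow> real" where h: "smooth h" "\<And>s. 0 \<le> h s" "\<And>s. h s \<le> 1"
    "\<And>s. s \<le> 1/2 \<Longrightarrow> h s = 1" "\<And>s. s \<ge> 1 \<Longrightarrow> h s = 0"
    using smooth_step_exists by blast
  define h1 where "h1 = dir_deriv 1 h"
  define h2 where "h2 = dir_deriv 1 h1"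
  have sm: "smooth h1" "smooth h2" by (auto simp: h1_def h2_def h(1) intro!: smooth_dir_deriv_1)
  have z1: "h1 s = 0" if "s < 1/2" for s
    unfolding h1_def by (rule dir_deriv_const_on_open[of "{..<1/2}" _ _ 1]) (use that h in auto)
  have z1': "h1 s = 0" if "s > 1" for s
    unfolding h1_def by (rule dir_deriv_const_on_open[of "{1<..}" _ _ 0]) (use that h in auto)
  have z2: "h2 s = 0" if "s < 1/2" for s
    unfolding h2_def by (rule dir_deriv_const_on_open[of "{..<1/2}" _ _ 0]) (use that z1 in auto)
  have z2': "h2 s = 0" if "s > 1" for s
    unfolding h2_def by (rule dir_deriv_const_on_open[of "{1<..}" _ _ 0]) (use that z1' in auto)
  obtain M1 where M1: "M1 > 0" "\<And>s. \<bar>h1 s\<bar> \<le> M1"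
    using bounded_if_zero_outside_Icc[OF smooth_imp_continuous_on[OF sm(1)] z1 z1'] by blast
  obtain M2 where M2: "M2 > 0" "\<And>s. \<bar>h2 s\<bar> \<le> M2"
    using bounded_if_zero_outside_Icc[OF smooth_imp_continuous_on[OF sm(2)] z2 z2'] by blast
  obtain k :: nat where k: "real k * (p - 1) \<ge> 2" "k \<ge> 1"
  proof -
    obtain k :: nat where k: "real k > 2 / (p - 1)" using reals_Archimedean2 by blast
    then have "real k > 0" using p by (meson divide_pos_pos less_trans diff_gt_0_iff_gt zero_less_numeral)
    with k p that[of k] show ?thesis by (auto simp: field_simps)
  qed
  \<comment> \<open>With \<open>m = k + 2\<close>, two derivatives of \<open>h ^ m\<close> still leave a factor \<open>h ^ k\<close>, and \<open>k \<ge> m / p\<close>.\<close>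
  define H where "H = (\<lambda>s. h s ^ (k + 2))"
  have D: "(h has_real_derivative h1 s) (at s)" "(h1 has_real_derivative h2 s) (at s)" for s
    using smooth_DERIV[OF h(1)] smooth_DERIV[OF sm(1)] by (simp_all add: h1_def h2_def)
  have H1: "dir_deriv 1 H = (\<lambda>s. real (k + 2) * h s ^ (k + 1) * h1 s)"
    unfolding H_def by (rule ext, rule dir_deriv_eq_DERIV)
      (rule derivative_eq_intros D refl | simp add: algebra_simps)+
  have H2: "dir_deriv 1 (dir_deriv 1 H) =
      (\<lambda>s. real (k + 2) * (real (k + 1) * h s ^ k * h1 s * h1 s + h s ^ (k + 1) * h2 s))"
    unfolding H1 by (rule ext, rule dir_deriv_eq_DERIV)
      (rule derivative_eq_intros D refl | simp add: algebra_simps)+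
  have pow: "h s ^ k \<le> H s powr (1 / p)" for s
  proof (cases "h s = 0")
    case True
    \<comment> \<open>\<open>k \<ge> 1\<close> matters here: at a zero of \<open>h\<close> the power
      with exponent 0 would be 1.\<close>
    with k show ?thesis by (simp add: H_def power_0_left)
  next
    case False
    then have pos: "h s > 0" using h(2)[of s] by linarith
    have "real (k + 2) * (1 / p) \<le> real k" using k p by (simp add: field_simps)
    then have "h s powr real k \<le> h s powr (real (k + 2) * (1 / p))"
      using pos h(3) by (intro powr_mono') auto
    moreover have "h s ^ k = h s powr real k" "H s = h s powr real (k + 2)"
      unfolding H_def using powr_realpow[OF pos] by metis+
    ultimately show ?thesis
      by (metis powr_powr)
  qed
  have pow': "h s ^ (k + 1) \<le> h s ^ k" for s
    by (rule power_decreasing) (use h in auto)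
  define C where "C = real (k + 2) * (M1 + real (k + 1) * M1 * M1 + M2)"
  show ?thesis
  proof
    show "smooth H" unfolding H_def by (intro smooth_power h)
    show "0 \<le> H s" "H s \<le> 1" for s unfolding H_def by (intro zero_le_power power_le_one h)+
    show "C > 0" unfolding C_def using M1 M2 by (intro mult_pos_pos add_pos_pos) auto
    show "H s = 1" if "s \<le> 1/2" for s using that h by (simp add: H_def)
    show "H s = 0" if "s \<ge> 1" for s using that h by (simp add: H_def)
    show "dir_deriv 1 H s = 0" if "s < 1/2" for s using that z1 by (simp add: H1)
    have hk: "0 \<le> h s ^ k" for s using h by simp
    show "\<bar>dir_deriv 1 H s\<bar> \<le> C * H s powr (1 / p)" for s
    proof -
      have "\<bar>dir_deriv 1 H s\<bar> = real (k + 2) * \<bar>h1 s\<bar> * h s ^ (k + 1)"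
        using h by (simp add: H1 abs_mult)
      also have "\<dots> \<le> (real (k + 2) * M1) * h s ^ k"
        using M1 pow' h by (intro mult_mono) auto
      also have "\<dots> \<le> C * h s ^ k"
        unfolding C_def using M1 M2 hk by (intro mult_right_mono mult_left_mono) auto
      also have "\<dots> \<le> C * H s powr (1 / p)"
        using pow \<open>C > 0\<close> by simp
      finally show ?thesis .
    qed
    show "\<bar>dir_deriv 1 (dir_deriv 1 H) s\<bar> \<le> C * H s powr (1 / p)" for s
    proof -
      have "\<bar>real (k + 1) * h s ^ k * h1 s * h1 s + h s ^ (k + 1) * h2 s\<bar>
          \<le> \<bar>real (k + 1) * h s ^ k * h1 s * h1 s\<bar> + \<bar>h s ^ (k + 1) * h2 s\<bar>"
        by (rule abs_triangle_ineq)
      also have "\<dots> = (real (k + 1) * (\<bar>h1 s\<bar> * \<bar>h1 s\<bar>)) * h s ^ k + \<bar>h2 s\<bar> * h s ^ (k + 1)"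
        using h by (simp add: abs_mult)
      also have "\<dots> \<le> (real (k + 1) * (M1 * M1)) * h s ^ k + M2 * h s ^ k"
        using M1 M2 pow' h by (intro add_mono mult_mono) auto
      also have "\<dots> = (real (k + 1) * M1 * M1 + M2) * h s ^ k"
        by (simp add: algebra_simps)
      finally have "\<bar>dir_deriv 1 (dir_deriv 1 H) s\<bar> \<le> real (k + 2) * ((real (k + 1) * M1 * M1 + M2) * h s ^ k)"
        unfolding H2 abs_mult by (intro mult_mono) auto
      also have "\<dots> \<le> C * h s ^ k"
        unfolding C_def using M1 M2 hk by (simp only: mult.assoc[symmetric], intro mult_right_mono mult_left_mono) auto
      also have "\<dots> \<le> C * H s powr (1 / p)"
        using pow \<open>C > 0\<close> by simp
      finally show ?thesis .
    qed
  qed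
qed

section \<open>The multiplier in time\<close>

text \<open>Bootstrapping: if \<open>g\<close> is \<open>Ck k\<close>, then so is the right-hand
  side, hence \<open>g\<close> is \<open>Ck (Suc k)\<close>.\<close>

lemma smooth_linear_ode:
  fixes w g :: "real \<Rightarrow> real"
  assumes w: "smooth w" and g: "\<And>t. (g has_real_derivative w t * g t - 1) (at t)"
  shows "smooth g"
proof -
  have eq: "dir_deriv 1 g = (\<lambda>t. w t * g t + (-1))"
    by (rule ext, rule dir_deriv_eq_DERIV) (use g in simp)
  have "Ck k g" for k
  proof (induction k)
    case 0
    then show ?case using g
      by (auto simp: continuous_on_eq_continuous_at intro: DERIV_isCont)
  next
    case (Suc k)
    have "Ck k w" using w by (simp add: smooth_def)
    with Suc have "Ck k (dir_deriv 1 g)"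
      unfolding eq by (intro Ck_add Ck_mult Ck_const)
    with g show ?case by (auto simp: real_differentiable_def)
  qed
  then show ?thesis by (simp add: smooth_def)
qed

lemma antiderivative_exists:
  fixes f :: "real \<Rightarrow> real"
  assumes "continuous_on UNIV f"
  obtains F where "\<And>x. (F has_real_derivative f x) (at x)" "F 0 = 0"
proof -
  have "isCont f x" for x using assms by (simp add: continuous_on_eq_continuous_at)
  then obtain F where F: "\<And>x. (F has_vector_derivative f x) (at x)"
    using einterval_antiderivative[of "-\<infinity>" "\<infinity>" f] by auto
  have "((\<lambda>x. F x - F 0) has_real_derivative f x) (at x)" for x
    using F[of x] by (auto simp: has_real_derivative_iff_has_vector_derivative[symmetric]
        intro!: derivative_eq_intros)
  then show ?thesis using that[of "\<lambda>x. F x - F 0"] by simp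
qed

lemma bounded_mono_tendsto:
  fixes f :: "real \<Rightarrow> real"
  assumes mono: "\<And>x y. a \<le> x \<Longrightarrow> x \<le> y \<Longrightarrow> f x \<le> f y" and bd: "\<And>x. a \<le> x \<Longrightarrow> f x \<le> M"
  obtains l where "(f \<longlongrightarrow> l) at_top"
proof
  let ?l = "SUP x\<in>{a..}. f x"
  have bdd: "bdd_above (f ` {a..})" using bd by (auto intro!: bdd_aboveI)
  have le: "f x \<le> ?l" if "a \<le> x" for x
    using that bdd by (intro cSUP_upper) auto
  show "(f \<longlongrightarrow> ?l) at_top"
  proof (rule order_tendstoI)
    fix y assume "y < ?l"
    then obtain x where x: "a \<le> x" "y < f x"
      using less_cSUP_iff[of "{a..}" f y] bdd by auto
    then show "\<forall>\<^sub>F x in at_top. y < f x"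
      using mono by (intro eventually_at_top_linorderI[of x]) (meson less_le_trans)
  next
    fix y assume "?l < y"
    then show "\<forall>\<^sub>F x in at_top. f x < y"
      using le by (intro eventually_at_top_linorderI[of a]) (meson le_less_trans)
  qed
qed

text \<open>
  The shift \<open>1 + t\<close> is made positive on the whole line by cutting it off for \<open>t \<le> -1/2\<close>,
  so that the coefficient of the equation for the weight is globally smooth.
\<close>

lemma smooth_damping_coefficient_exists:
  obtains w :: "real \<Rightarrow> real"
  where "smooth w" "\<And>t. t > -1/2 \<Longrightarrow> w t = (1 + t) powr (- \<beta>)"
proof -
  obtain h :: "real \<Rightarrow> real" where h: "smooth h" "\<And>s. 0 \<le> h s" "\<And>s. h s \<le> 1"
    "\<And>s. s \<le> 1/2 \<Longrightarrow> h s = 1" "\<And>s. s \<ge> 1 \<Longrightarrow> h s = 0"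
    using smooth_step_exists by blast
  define q where "q = (\<lambda>t. 1 + t * h ((-1) * t))"
  have pos: "q t > 0" for t
  proof -
    consider "t \<le> -1" | "-1 < t" "t < 0" | "t \<ge> 0" by linarith
    then show ?thesis
    proof cases
      case 2
      have "t * h ((-1) * t) \<ge> t * 1"
        using h(3)[of "-t"] 2 by (intro mult_left_mono_neg) auto
      then have "q t \<ge> 1 + t" by (simp add: q_def)
      with 2 show ?thesis by linarith
    qed (use h in \<open>auto simp: q_def intro!: add_pos_nonneg\<close>)
  qed
  have id: "smooth (\<lambda>s::real. s)"
    by (intro smooth_bounded_linear bounded_linear_ident)
  have "smooth q"
    unfolding q_def
    by (intro smooth_add smooth_mult smooth_const id smooth_compose[OF h(1)])
  then have "smooth (\<lambda>t. q t powr (- \<beta>))"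
    by (intro smooth_powr pos)
  moreover have "q t powr (- \<beta>) = (1 + t) powr (- \<beta>)" if "t > -1/2" for t
    using that h by (simp add: q_def)
  ultimately show ?thesis using that by blast
qed

text \<open>The fraction in the exponent is the integral of the damping coefficient from 0 to t. The
  limit makes the correction term in the comparison functions of \<open>weight_exists\<close> vanish
  at infinity.\<close>

lemma stretched_exp_tendsto_0:
  fixes \<beta> :: real
  assumes "\<beta> < 1"
  shows "((\<lambda>t. (1 + t) powr \<beta> * exp (- (((1 + t) powr (1 - \<beta>) - 1) / (1 - \<beta>)))) \<longlongrightarrow> 0) at_top"
  using assms by real_asymp

text \<open>With P the primitive of w, the weight is g(t) = exp(P(t)) times the integral of exp(-P)
  over (t, \<infinity>); at t = 0 this is the integral defining \<open>B_const\<close>, hence the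
  value \<open>inverse (B_const \<beta>)\<close>. The two-sided bound on \<open>g\<close> amounts to
  comparing the tail integral with \<open>(1 + t) powr \<beta> * exp (- P t)\<close>.\<close>

lemma weight_exists:
  fixes \<beta> :: real
  assumes \<beta>: "-1 < \<beta>" "\<beta> < 1"
  obtains g w :: "real \<Rightarrow> real" and c C
  where "smooth g" "smooth w" "c > 0" "C > 0"
    "\<And>t. t > -1/2 \<Longrightarrow> w t = (1 + t) powr (- \<beta>)"
    "\<And>t. (g has_real_derivative w t * g t - 1) (at t)"
    "g 0 = inverse (B_const \<beta>)"
    "\<And>t. t \<ge> 0 \<Longrightarrow> c * (1 + t) powr \<beta> \<le> g t" "\<And>t. t \<ge> 0 \<Longrightarrow> g t \<le> C * (1 + t) powr \<beta>"
    "\<beta> = 0 \<Longrightarrow> (\<And>t. t \<ge> 0 \<Longrightarrow> g t = 1)"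
proof -
  obtain w where w: "smooth w" "\<And>t. t > -1/2 \<Longrightarrow> w t = (1 + t) powr (- \<beta>)"
    using smooth_damping_coefficient_exists[of \<beta>] by blast
  obtain P where P: "\<And>x. (P has_real_derivative w x) (at x)" "P 0 = 0"
    using antiderivative_exists[OF smooth_imp_continuous_on[OF w(1)]] by blast
  have contP: "continuous_on UNIV P"
    using P by (auto simp: continuous_on_eq_continuous_at intro: DERIV_isCont)
  obtain E where E: "\<And>x. (E has_real_derivative exp (- P x)) (at x)" "E 0 = 0"
    using antiderivative_exists[of "\<lambda>x. exp (- P x)"] continuous_on_exp[OF continuous_on_minus[OF contP]]
    by blast

  have dpow: "((\<lambda>t. (1 + t) powr a) has_real_derivative a * (1 + s) powr (a - 1)) (at s)" if "s \<ge> 0" for s a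
    using DERIV_chain2[of "\<lambda>z. z powr a" "a * (1 + s) powr (a - 1)" "\<lambda>t. 1 + t" s 1]
      has_real_derivative_powr[of "1 + s" a] that
    by (auto intro!: derivative_eq_intros)
  have P_eq: "P t = ((1 + t) powr (1 - \<beta>) - 1) / (1 - \<beta>)" if "t \<ge> 0" for t
  proof -
    let ?f = "\<lambda>t. P t - ((1 + t) powr (1 - \<beta>) - 1) / (1 - \<beta>)"
    have D: "(?f has_real_derivative 0) (at s)" if "s \<ge> 0" for s
    proof -
      have "(?f has_real_derivative w s - ((1 - \<beta>) * (1 + s) powr (1 - \<beta> - 1) - 0) / (1 - \<beta>)) (at s)"
        using that by (intro DERIV_diff DERIV_cdivide dpow P(1) DERIV_const) auto
      with that \<beta> w(2)[of s] show ?thesis by simp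
    qed
    have "continuous_on {0..t} ?f"
      using D by (intro continuous_at_imp_continuous_on ballI DERIV_isCont[where D=0]) simp
    then have "?f t = ?f 0"
      using that D by (cases "t = 0") (simp, intro DERIV_isconst_end[of 0 t], simp_all)
    with P(2) show ?thesis by simp
  qed

  have B_eq: "(LBINT s:{0..t}. (1 + s) powr (- \<beta>)) = P t" if "t \<ge> 0" for t
  proof -
    have "(\<integral>s. w s * indicator {0..t} s \<partial>lborel) = P t - P 0"
      using that P(1) smooth_imp_continuous_on[OF w(1), of UNIV]
      by (intro integral_FTC_Icc_real) (auto simp: continuous_on_eq_continuous_at)
    moreover have "(LBINT s:{0..t}. (1 + s) powr (- \<beta>)) = (\<integral>s. w s * indicator {0..t} s \<partial>lborel)"
      unfolding set_lebesgue_integral_def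
      by (rule Bochner_Integration.integral_cong) (auto simp: indicator_def w(2))
    ultimately show ?thesis using P(2) by simp
  qed

  \<comment> \<open>\<open>exp (- P)\<close> divided by the damping coefficient: the leading term of
    the tail integral of \<open>exp (- P)\<close> after one integration by parts.\<close>
  define H where "H = (\<lambda>t. (1 + t) powr \<beta> * exp (- P t))"
  have Hlim: "(H \<longlongrightarrow> 0) at_top"
    using stretched_exp_tendsto_0[OF \<beta>(2)]
    by (rule Lim_transform_eventually)
      (auto simp: H_def P_eq intro!: eventually_at_top_linorderI[of 0])
  have DH: "(H has_real_derivative (\<beta> * (1 + t) powr (\<beta> - 1) - 1) * exp (- P t)) (at t)" if "t \<ge> 0" for t
  proof -
    have "w t * (1 + t) powr \<beta> = 1"
      using that w(2)[of t] by (simp add: powr_minus)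
    then have "(1 + t) powr \<beta> * (exp (- P t) * w t) = exp (- P t)"
      by (metis mult.commute mult.left_commute mult.right_neutral)
    then show ?thesis
      unfolding H_def
      by (intro DERIV_cong[OF DERIV_mult[OF dpow[OF that] DERIV_fun_exp[OF DERIV_minus[OF P(1)]]]])
        (simp add: algebra_simps)
  qed
  \<comment> \<open>The ratio of \<open>- H'\<close> to \<open>exp (- P)\<close> is
    \<open>1 - \<beta> * (1 + t) powr (\<beta> - 1)\<close>. For \<open>t \<ge> 0\<close> it lies
    between \<open>1 - max \<beta> 0\<close> and \<open>1 + \<bar>\<beta>\<bar>\<close>, whose
    reciprocals are \<open>C\<close> and \<open>c\<close>. Thus \<open>E + C * H\<close> decreases
    and \<open>E + c * H\<close> increases, both towards the limit of \<open>E\<close>.\<close>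
  define c where "c = inverse (1 + \<bar>\<beta>\<bar>)"
  define C where "C = inverse (1 - max \<beta> 0)"
  have cC: "c > 0" "C > 0" using \<beta> by (auto simp: c_def C_def)
  have Hpos: "H t \<ge> 0" for t by (simp add: H_def)
  have one: "(1 + t) powr (\<beta> - 1) \<le> 1" if "t \<ge> 0" for t
    using powr_mono[of "\<beta> - 1" 0 "1 + t"] that \<beta> by simp
  have C1: "1 \<le> C * (1 - \<beta> * (1 + t) powr (\<beta> - 1))" if "t \<ge> 0" for t
  proof -
    have "\<beta> * (1 + t) powr (\<beta> - 1) \<le> max \<beta> 0 * 1"
      using one[OF that] by (intro mult_mono) auto
    then show ?thesis using \<beta> by (simp add: C_def field_simps)
  qed
  have c1: "c * (1 - \<beta> * (1 + t) powr (\<beta> - 1)) \<le> 1" if "t \<ge> 0" for t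
  proof -
    have "\<bar>\<beta>\<bar> * (1 + t) powr (\<beta> - 1) \<le> \<bar>\<beta>\<bar> * 1"
      using one[OF that] by (intro mult_mono) auto
    moreover have "- \<beta> * (1 + t) powr (\<beta> - 1) \<le> \<bar>\<beta>\<bar> * (1 + t) powr (\<beta> - 1)"
      by (intro mult_right_mono) auto
    ultimately show ?thesis by (simp add: c_def field_simps)
  qed
  have DC: "((\<lambda>t. E t + K * H t) has_real_derivative
      (1 - K * (1 - \<beta> * (1 + t) powr (\<beta> - 1))) * exp (- P t)) (at t)" if "t \<ge> 0" for t K
    using that by (auto intro!: derivative_eq_intros E(1) DH simp: algebra_simps)
  have dec: "E y + C * H y \<le> E x + C * H x" if "0 \<le> x" "x \<le> y" for x y
  proof (rule DERIV_nonpos_imp_nonincreasing[OF that(2)])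
    fix t assume "x \<le> t" "t \<le> y"
    with that have t: "t \<ge> 0" by simp
    have "(1 - C * (1 - \<beta> * (1 + t) powr (\<beta> - 1))) * exp (- P t) \<le> 0"
      using C1[OF t] by (intro mult_nonpos_nonneg) auto
    with DC[OF t] show "\<exists>D. ((\<lambda>t. E t + C * H t) has_real_derivative D) (at t) \<and> D \<le> 0"
      by blast
  qed
  have inc: "E x + c * H x \<le> E y + c * H y" if "0 \<le> x" "x \<le> y" for x y
  proof (rule DERIV_nonneg_imp_nondecreasing[OF that(2)])
    fix t assume "x \<le> t" "t \<le> y"
    with that have t: "t \<ge> 0" by simp
    have "(1 - c * (1 - \<beta> * (1 + t) powr (\<beta> - 1))) * exp (- P t) \<ge> 0"
      using c1[OF t] by (intro mult_nonneg_nonneg) auto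
    with DC[OF t] show "\<exists>D. ((\<lambda>t. E t + c * H t) has_real_derivative D) (at t) \<and> D \<ge> 0"
      by blast
  qed
  have Emono: "E x \<le> E y" if "x \<le> y" for x y
    by (rule DERIV_nonneg_imp_nondecreasing[OF that]) (use E(1) exp_ge_zero in blast)
  \<comment> \<open>Boundedness of \<open>E\<close> is the convergence of the integral that defines
    \<open>B_const\<close>.\<close>
  have Ebd: "E x \<le> C * H 0" if "0 \<le> x" for x
  proof -
    have "0 \<le> C * H x" using cC Hpos by simp
    with dec[of 0 x] that E(2) show ?thesis by linarith
  qed
  obtain I where I: "(E \<longlongrightarrow> I) at_top"
    by (rule bounded_mono_tendsto[of 0 E "C * H 0", OF Emono Ebd])
  have up: "I \<le> E t + C * H t" if "t \<ge> 0" for t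
  proof (rule tendsto_upperbound)
    show "((\<lambda>t. E t + C * H t) \<longlongrightarrow> I) at_top"
      using tendsto_add[OF I tendsto_mult_left[OF Hlim, of C]] by simp
    show "\<forall>\<^sub>F s in at_top. E s + C * H s \<le> E t + C * H t"
      using that dec by (intro eventually_at_top_linorderI[of t]) auto
  qed simp
  have lo: "E t + c * H t \<le> I" if "t \<ge> 0" for t
  proof (rule tendsto_lowerbound)
    show "((\<lambda>t. E t + c * H t) \<longlongrightarrow> I) at_top"
      using tendsto_add[OF I tendsto_mult_left[OF Hlim, of c]] by simp
    show "\<forall>\<^sub>F s in at_top. E t + c * H t \<le> E s + c * H s"
      using that inc by (intro eventually_at_top_linorderI[of t]) auto
  qed simp

  have I_eq: "I = inverse (B_const \<beta>)"
  proof -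
    have "(\<integral>\<^sup>+ x. ennreal (exp (- P x)) * indicator {0..} x \<partial>lborel) = ennreal (I - E 0)"
      by (rule nn_integral_FTC_atLeast[OF _ E(1) _ I])
        (simp_all add: borel_measurable_continuous_onI continuous_on_exp continuous_on_minus contP)
    then have "(\<integral>\<^sup>+ x. ennreal (indicator {0..} x * exp (- P x)) \<partial>lborel) = ennreal I"
      using E(2) by (simp add: ennreal_mult' ennreal_indicator mult.commute)
    moreover have "0 \<le> I"
    proof -
      have "0 \<le> c * H 0" using cC Hpos by simp
      with lo[of 0] E(2) show ?thesis by linarith
    qed
    moreover have "P \<in> borel_measurable borel" using contP by (rule borel_measurable_continuous_onI)
    ultimately have "(LBINT x:{0..}. exp (- P x)) = I"
      unfolding set_lebesgue_integral_def
      by (subst integral_eq_nn_integral) auto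
    moreover have "(LBINT t:{0..}. exp (- (LBINT s:{0..t}. (1 + s) powr (- \<beta>)))) = (LBINT x:{0..}. exp (- P x))"
      by (rule set_lebesgue_integral_cong) (auto simp: B_eq)
    ultimately show ?thesis by (simp add: B_const_def)
  qed

  define g where "g = (\<lambda>t. exp (P t) * (I - E t))"
  have ode: "(g has_real_derivative w t * g t - 1) (at t)" for t
    unfolding g_def
    by (auto intro!: derivative_eq_intros P(1) E(1) simp: exp_minus field_simps)
  have gH: "exp (P t) * (K * H t) = K * (1 + t) powr \<beta>" for t K
    by (simp add: H_def exp_minus field_simps)
  have glo: "c * (1 + t) powr \<beta> \<le> g t" if "t \<ge> 0" for t
    unfolding gH[symmetric] g_def using lo[OF that] by (intro mult_left_mono) auto
  have gup: "g t \<le> C * (1 + t) powr \<beta>" if "t \<ge> 0" for t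
    unfolding gH[symmetric] g_def using up[OF that] by (intro mult_left_mono) auto
  show ?thesis
  proof (rule that[of g w c C])
    \<comment> \<open>For \<open>\<beta> = 0\<close> both constants are 1, so the lower and the
      upper bound coincide.\<close>
    show "g t = 1" if "\<beta> = 0" "t \<ge> 0" for t
      using that glo[of t] gup[of t] by (simp add: c_def C_def)
    show "g 0 = inverse (B_const \<beta>)"
      unfolding I_eq[symmetric] by (simp add: g_def P E)
  qed (use w cC ode smooth_linear_ode[OF w(1) ode] glo gup in auto)
qed

section \<open>Derivatives of product test functions\<close>

lemma dir_deriv_zero:
  assumes "f differentiable at x"
  shows "dir_deriv 0 f x = 0"
  using linear_simps(3)[OF has_derivative_bounded_linear[OF frechet_derivative_worksD[OF assms]]]
  by (simp add: dir_deriv_def)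

lemma dir_deriv_product:
  fixes a :: "real \<Rightarrow> real" and k :: "'a::euclidean_space \<Rightarrow> real"
  assumes "smooth a" "smooth k"
  shows "dir_deriv b (\<lambda>z. a (fst z) * k (snd z)) z =
    dir_deriv 1 a (fst z) * fst b * k (snd z) + a (fst z) * dir_deriv (snd b) k (snd z)"
proof -
  have d: "a differentiable at (fst z)" "k differentiable at (snd z)"
    using assms by (auto intro: smooth_imp_differentiable)
  have "(\<lambda>z. a (fst z)) differentiable at z" "(\<lambda>z. k (snd z)) differentiable at z"
    using smooth_fst[OF assms(1)] smooth_snd[OF assms(2)] by (auto intro: smooth_imp_differentiable)
  then show ?thesis
    by (simp add: dir_deriv_mult dir_deriv_fst[OF DERIV_dir_deriv[OF d(1)]] dir_deriv_snd[OF d(2)])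
qed

lemma smooth_product:
  fixes a :: "real \<Rightarrow> real" and k :: "'a::euclidean_space \<Rightarrow> real"
  shows "smooth a \<Longrightarrow> smooth k \<Longrightarrow> smooth (\<lambda>z. a (fst z) * k (snd z))"
  by (intro smooth_mult smooth_fst smooth_snd)

lemma dt_product:
  fixes a :: "real \<Rightarrow> real" and k :: "real^'n \<Rightarrow> real"
  assumes "smooth a" "smooth k"
  shows "dt (\<lambda>z. a (fst z) * k (snd z)) = (\<lambda>z. dir_deriv 1 a (fst z) * k (snd z))"
  by (rule ext) (simp add: dir_deriv_product[OF assms] dir_deriv_zero smooth_imp_differentiable[OF assms(2)])

lemma laplace_x_product:
  fixes a :: "real \<Rightarrow> real" and k :: "real^'n \<Rightarrow> real"
  assumes "smooth a" "smooth k"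
  shows "laplace_x (\<lambda>z. a (fst z) * k (snd z)) z =
    a (fst z) * (\<Sum>i\<in>UNIV. dir_deriv (axis i 1) (dir_deriv (axis i 1) k) (snd z))"
proof -
  have eq: "dir_deriv (0, v) (\<lambda>z. a (fst z) * k (snd z)) = (\<lambda>z. a (fst z) * dir_deriv v k (snd z))"
    if "smooth k" for v and k :: "real^'n \<Rightarrow> real"
    by (rule ext) (simp add: dir_deriv_product[OF assms(1) that])
  have "smooth (dir_deriv (axis i 1) k)" for i
    using assms(2) by (rule smooth_dir_deriv_Basis) (auto simp: axis_in_Basis_iff)
  then show ?thesis
    by (simp add: laplace_x_def eq assms(2) sum_distrib_left)
qed

text \<open>The profile is composed with the squared norm, which unlike the norm is smooth at the
  origin.\<close>

lemma smooth_radial: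
  fixes H :: "real \<Rightarrow> real"
  assumes "smooth H"
  shows "smooth (\<lambda>x::'a::euclidean_space. H (s * (x \<bullet> x)))"
  by (rule smooth_compose[OF assms]) (intro smooth_mult smooth_const smooth_inner_self)

lemma dir_deriv_radial:
  fixes H :: "real \<Rightarrow> real"
  assumes "smooth H"
  shows "dir_deriv v (\<lambda>x::'a::euclidean_space. H (s * (x \<bullet> x))) x =
    dir_deriv 1 H (s * (x \<bullet> x)) * (2 * s * (x \<bullet> v))"
proof -
  have *: "((\<lambda>x::'a. s * (x \<bullet> x)) has_derivative (\<lambda>h. s * (x \<bullet> h + h \<bullet> x))) (at x)"
    by (auto intro!: derivative_eq_intros)
  show ?thesis
    using dir_deriv_compose[of H _ "\<lambda>x::'a. s * (x \<bullet> x)", OF smooth_DERIV[OF assms]] *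
    by (simp add: dir_deriv_eq[OF *] inner_commute differentiableI)
qed

lemma dir_deriv2_radial:
  fixes H :: "real \<Rightarrow> real"
  assumes H: "smooth H"
  shows "dir_deriv v (dir_deriv v (\<lambda>x::'a::euclidean_space. H (s * (x \<bullet> x)))) x =
    dir_deriv 1 (dir_deriv 1 H) (s * (x \<bullet> x)) * (2 * s * (x \<bullet> v))\<^sup>2
    + dir_deriv 1 H (s * (x \<bullet> x)) * (2 * s * (v \<bullet> v))"
proof -
  note H' = smooth_dir_deriv_1[OF H]
  have eq: "dir_deriv v (\<lambda>x::'a. H (s * (x \<bullet> x))) =
      (\<lambda>x. dir_deriv 1 H (s * (x \<bullet> x)) * (2 * s * (x \<bullet> v)))"
    by (rule ext) (rule dir_deriv_radial[OF H])
  have lin: "((\<lambda>x::'a. 2 * s * (x \<bullet> v)) has_derivative (\<lambda>h. 2 * s * (h \<bullet> v))) (at x)"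
    by (auto intro!: derivative_eq_intros)
  show ?thesis
    unfolding eq
    by (subst dir_deriv_mult)
      (simp_all add: smooth_imp_differentiable[OF smooth_radial[OF H']] differentiableI[OF lin]
        dir_deriv_radial[OF H'] dir_deriv_eq[OF lin] power2_eq_square)
qed

lemma laplacian_radial:
  fixes H :: "real \<Rightarrow> real"
  assumes H: "smooth H"
  shows "(\<Sum>i\<in>UNIV. dir_deriv (axis i 1) (dir_deriv (axis i 1) (\<lambda>x::real^'n. H (s * (x \<bullet> x)))) x) =
    dir_deriv 1 (dir_deriv 1 H) (s * (x \<bullet> x)) * (4 * s\<^sup>2 * (x \<bullet> x))
    + dir_deriv 1 H (s * (x \<bullet> x)) * (2 * s * real CARD('n))"
proof -
  have "x \<bullet> x = (\<Sum>i\<in>UNIV. (x $ i)\<^sup>2)" by (simp add: inner_vec_def power2_eq_square)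
  then show ?thesis
    by (simp add: dir_deriv2_radial[OF H] inner_axis sum.distrib power_mult_distrib sum_distrib_left algebra_simps)
qed

section \<open>Powers of the Japanese bracket and the damping term\<close>

lemma japanese_powr: "japanese x powr (- \<alpha>) = (1 + x \<bullet> x) powr (- \<alpha> / 2)"
proof -
  have "1 + x \<bullet> x > 0" by (simp add: add_pos_nonneg)
  then have "japanese x = (1 + x \<bullet> x) powr (1 / 2)"
    by (simp add: japanese_def power2_norm_eq_inner powr_half_sqrt)
  then show ?thesis by (simp add: powr_powr)
qed

lemma smooth_japanese_powr: "smooth (\<lambda>x::real^'n. japanese x powr (- \<alpha>))"
  unfolding japanese_powr
  by (intro smooth_powr smooth_add smooth_const smooth_inner_self) (simp add: add_pos_nonneg)

lemma japanese_powr_bounds: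
  assumes "\<alpha> \<ge> 0"
  shows "0 < japanese x powr (- \<alpha>)" "japanese x powr (- \<alpha>) \<le> 1"
proof -
  have ge: "japanese x \<ge> 1" by (simp add: japanese_def)
  then show "0 < japanese x powr (- \<alpha>)" by simp
  show "japanese x powr (- \<alpha>) \<le> 1"
    using powr_mono[of "- \<alpha>" 0 "japanese x"] ge assms by simp
qed

text \<open>\<open>damping\<close> itself is not smooth on the whole space-time. It agrees with a
  globally smooth product for times above -1/2, a neighbourhood of all \<open>t \<ge> 0\<close>; at
  \<open>t = 0\<close> this is needed because \<open>dt\<close> is a two-sided derivative.\<close>

lemma dt_damping_product:
  fixes a w :: "real \<Rightarrow> real" and k :: "real^'n \<Rightarrow> real"
  assumes a: "smooth a" and k: "smooth k" and w: "smooth w"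
    and w_eq: "\<And>t. t > -1/2 \<Longrightarrow> w t = (1 + t) powr (- \<beta>)" and t: "t \<ge> 0"
  shows "dt (\<lambda>z. damping \<alpha> \<beta> z * (a (fst z) * k (snd z))) (t, x) =
    dir_deriv 1 (\<lambda>t. w t * a t) t * (japanese x powr (- \<alpha>) * k x)"
proof -
  let ?F = "\<lambda>z::real \<times> (real^'n). (w (fst z) * a (fst z)) * (japanese (snd z) powr (- \<alpha>) * k (snd z))"
  have wa: "smooth (\<lambda>t. w t * a t)" by (intro smooth_mult w a)
  have jk: "smooth (\<lambda>x::real^'n. japanese x powr (- \<alpha>) * k x)"
    by (intro smooth_mult smooth_japanese_powr k)
  have "open ({-1/2::real<..} \<times> (UNIV :: (real^'n) set))" by (intro open_Times) auto
  then have "dt (\<lambda>z. damping \<alpha> \<beta> z * (a (fst z) * k (snd z))) (t, x) = dt ?F (t, x)"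
    unfolding dir_deriv_def
    by (subst frechet_derivative_transform_within_open[of ?F, symmetric])
      (use t in \<open>auto simp: damping_def w_eq intro!: smooth_imp_differentiable smooth_product[OF wa jk]\<close>)
  then show ?thesis
    using dt_product[OF wa jk] by (simp add: fun_eq_iff)
qed

text \<open>Since \<open>w * g = g' + 1\<close>, the expression equals
  \<open>(1 - j) * g'' * e + (2 * g' - j * (g' + 1)) * e' + g * e''\<close>. The first term vanishes
  in both cases of the hypothesis on \<open>\<beta>\<close> and \<open>j\<close>. If
  \<open>j = 1\<close>, the coefficient of \<open>e'\<close> is \<open>g' - 1 = w * g - 2\<close>,
  bounded by \<open>C + 2\<close>; if \<open>\<beta> = 0\<close>, it is \<open>- j\<close>. The
  factor \<open>j\<close> is kept because its decay in \<open>x\<close> determines the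
  regime.\<close>

lemma time_factor_bound:
  fixes \<alpha> \<beta> :: real and g w e :: "real \<Rightarrow> real"
  assumes g: "smooth g" and w: "smooth w" and e: "smooth e"
    and w_eq: "\<And>t. t > -1/2 \<Longrightarrow> w t = (1 + t) powr (- \<beta>)"
    and ode: "\<And>t. (g has_real_derivative w t * g t - 1) (at t)"
    and g_ge: "\<And>t. t \<ge> 0 \<Longrightarrow> 0 \<le> g t"
    and g_le: "\<And>t. t \<ge> 0 \<Longrightarrow> g t \<le> C * (1 + t) powr \<beta>"
    and g_1: "\<beta> = 0 \<Longrightarrow> (\<And>t. t \<ge> 0 \<Longrightarrow> g t = 1)"
    and \<alpha>\<beta>: "\<beta> = 0 \<or> j = 1" and j: "0 \<le> j" and t: "t \<ge> 0" and C: "C \<ge> 0"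
  shows "\<bar>dir_deriv 1 (dir_deriv 1 (\<lambda>t. g t * e t)) t - j * dir_deriv 1 (\<lambda>t. w t * (g t * e t)) t\<bar>
    \<le> g t * \<bar>dir_deriv 1 (dir_deriv 1 e) t\<bar> + (C + 2) * j * \<bar>dir_deriv 1 e t\<bar>"
proof -
  define w1 where "w1 = dir_deriv 1 w"
  define c1 where "c1 = dir_deriv 1 e"
  define c2 where "c2 = dir_deriv 1 c1"
  define g1 where "g1 = (\<lambda>t. w t * g t - 1)"
  define g2 where "g2 = (\<lambda>t. w1 t * g t + w t * g1 t)"
  have Dw: "(w has_real_derivative w1 t) (at t)" for t
    using smooth_DERIV[OF w] by (simp add: w1_def)
  have Dc: "(e has_real_derivative c1 t) (at t)" "(c1 has_real_derivative c2 t) (at t)" for t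
    using smooth_DERIV[OF e] smooth_DERIV[OF smooth_dir_deriv_1[OF e]] by (simp_all add: c1_def c2_def)
  have Dg: "(g has_real_derivative g1 t) (at t)" for t
    using ode by (simp add: g1_def)
  have Dg1: "(g1 has_real_derivative g2 t) (at t)" for t
    unfolding g1_def[abs_def] g2_def by (auto intro!: derivative_eq_intros Dg Dw simp: g1_def algebra_simps)
  have 1: "dir_deriv 1 (\<lambda>t. g t * e t) = (\<lambda>t. g1 t * e t + g t * c1 t)"
    by (rule ext, rule dir_deriv_eq_DERIV) (auto intro!: derivative_eq_intros Dg Dc simp: algebra_simps)
  have 2: "dir_deriv 1 (dir_deriv 1 (\<lambda>t. g t * e t)) t = g2 t * e t + 2 * (g1 t * c1 t) + g t * c2 t"
    unfolding 1 by (rule dir_deriv_eq_DERIV) (auto intro!: derivative_eq_intros Dg Dg1 Dc simp: algebra_simps)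
  have 3: "dir_deriv 1 (\<lambda>t. w t * (g t * e t)) t = g2 t * e t + (g1 t + 1) * c1 t"
    by (rule dir_deriv_eq_DERIV)
      (auto intro!: derivative_eq_intros Dg Dw Dc simp: g2_def g1_def algebra_simps)
  have "\<bar>g2 t * e t + 2 * (g1 t * c1 t) + g t * c2 t - j * (g2 t * e t + (g1 t + 1) * c1 t)\<bar>
      \<le> g t * \<bar>c2 t\<bar> + (C + 2) * j * \<bar>c1 t\<bar>"
  proof (cases "\<beta> = 0")
    case True
    have "w1 t = 0"
      unfolding w1_def by (rule dir_deriv_const_on_open[of "{-1/2<..}" _ _ 1]) (use t w_eq True in auto)
    moreover have "g1 t = 0" using g_1[OF True] w_eq[of t] t True by (simp add: g1_def)
    ultimately have "g2 t * e t + 2 * (g1 t * c1 t) + g t * c2 t - j * (g2 t * e t + (g1 t + 1) * c1 t)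
        = g t * c2 t - j * c1 t"
      by (simp add: g2_def)
    also have "\<bar>\<dots>\<bar> \<le> g t * \<bar>c2 t\<bar> + j * \<bar>c1 t\<bar>"
      using g_ge[OF t] j by (intro order_trans[OF abs_triangle_ineq4]) (simp add: abs_mult)
    also have "\<dots> \<le> g t * \<bar>c2 t\<bar> + (C + 2) * j * \<bar>c1 t\<bar>"
      using C j mult_right_mono[of 1 "C + 2" "j * \<bar>c1 t\<bar>"] by simp
    finally show ?thesis .
  next
    case False
    with \<alpha>\<beta> have j1: "j = 1" by simp
    have "w t * g t \<le> C"
    proof -
      have "w t * g t \<le> (1 + t) powr (- \<beta>) * (C * (1 + t) powr \<beta>)"
        using w_eq[of t] g_le[OF t] t by (intro mult_mono) (auto simp: g_ge)
      also have "\<dots> = C" using t by (simp add: powr_minus)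
      finally show ?thesis .
    qed
    moreover have "0 \<le> w t * g t" using w_eq[of t] g_ge[OF t] t by simp
    ultimately have b: "\<bar>g1 t - 1\<bar> \<le> C + 2" by (simp add: g1_def)
    have "g2 t * e t + 2 * (g1 t * c1 t) + g t * c2 t - j * (g2 t * e t + (g1 t + 1) * c1 t)
        = g t * c2 t + (g1 t - 1) * c1 t"
      by (simp add: j1 algebra_simps)
    also have "\<bar>\<dots>\<bar> \<le> g t * \<bar>c2 t\<bar> + \<bar>g1 t - 1\<bar> * \<bar>c1 t\<bar>"
      using g_ge[OF t] by (intro order_trans[OF abs_triangle_ineq]) (simp add: abs_mult)
    also have "\<dots> \<le> g t * \<bar>c2 t\<bar> + (C + 2) * j * \<bar>c1 t\<bar>"
      using b j1 by (simp add: mult_right_mono)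
    finally show ?thesis .
  qed
  then show ?thesis by (simp add: 2 3 c1_def c2_def)
qed

section \<open>Integrals of powers of the Japanese bracket\<close>

lemma norm_le_japanese: "norm x \<le> japanese x"
  unfolding japanese_def by (rule real_le_rsqrt) simp

lemma continuous_on_japanese_powr: "continuous_on S (\<lambda>x. japanese x powr r)"
  using smooth_imp_continuous_on[OF smooth_japanese_powr[of "- r"]] by simp

lemma integrable_japanese_powr_cball:
  "integrable lborel (\<lambda>x::real^'n. indicator (cball 0 L) x * japanese x powr r)"
  using borel_integrable_compact[OF compact_cball continuous_on_japanese_powr, of 0 L r]
  by (simp add: scaleR_conv_of_real)

lemma measure_cball_scale:
  assumes "r > 0"
  shows "measure lborel (cball (0::real^'n) r) = r ^ CARD('n) * measure lborel (cball (0::real^'n) 1)"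
  using assms by (simp add: content_cball)

text \<open>Outside the ball of radius \<open>r\<close> the integrand is at most
  \<open>r powr (- \<gamma>)\<close>, and the volume of the shell is estimated by that of the full
  ball of radius \<open>2 * r\<close>.\<close>

lemma japanese_powr_integral_step:
  fixes \<gamma> r :: real
  assumes "\<gamma> \<ge> 0" "r > 0"
  defines "J \<equiv> \<lambda>L. LINT x|lborel. indicator (cball (0::real^'n) L) x * japanese x powr (- \<gamma>)"
  shows "J (2 * r) \<le> J r + r powr (- \<gamma>) * (2 * r) ^ CARD('n) * measure lborel (cball (0::real^'n) 1)"
proof -
  have pt: "indicator (cball 0 (2 * r)) x * japanese x powr (- \<gamma>)
      \<le> indicator (cball 0 r) x * japanese x powr (- \<gamma>) + r powr (- \<gamma>) * indicator (cball 0 (2 * r)) x"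
    for x :: "real^'n"
  proof (cases "x \<in> cball 0 r")
    case False
    then have "r \<le> japanese x" using norm_le_japanese[of x] by simp
    then have "japanese x powr (- \<gamma>) \<le> r powr (- \<gamma>)"
      using assms by (intro powr_mono2') auto
    with False show ?thesis by (auto simp: indicator_def)
  qed (use assms in \<open>auto simp: indicator_def\<close>)
  have fin: "integrable lborel (indicator (cball (0::real^'n) (2 * r)) :: _ \<Rightarrow> real)"
    by (rule integrable_real_indicator) (auto simp: emeasure_lborel_cball_finite[unfolded infinity_ennreal_def])
  have "J (2 * r) \<le> (LINT x|lborel. indicator (cball (0::real^'n) r) x * japanese x powr (- \<gamma>)
      + r powr (- \<gamma>) * indicator (cball 0 (2 * r)) x)"
    unfolding J_def
    by (intro integral_mono pt integrable_japanese_powr_cball Bochner_Integration.integrable_add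
        integrable_mult_right fin)
  also have "\<dots> = J r + r powr (- \<gamma>) * measure lborel (cball (0::real^'n) (2 * r))"
    unfolding J_def using fin integrable_japanese_powr_cball[of r "- \<gamma>"]
    by (subst Bochner_Integration.integral_add) auto
  finally show ?thesis using assms measure_cball_scale[of "2 * r", where 'n='n] by simp
qed

text \<open>The shell between radii 2^k and 2^(k+1) contributes a multiple of the power k+1 of the
  ratio 2^(n - \<gamma>), n being the dimension. Whether this ratio is above, equal to or below 1
  separates the three growth rates.\<close>

lemma japanese_powr_integral_dyadic:
  fixes \<gamma> :: real
  assumes "\<gamma> \<ge> 0"
  defines "J \<equiv> \<lambda>L. LINT x|lborel. indicator (cball (0::real^'n) L) x * japanese x powr (- \<gamma>)"
  shows "J (2 ^ k) \<le> 2 powr \<gamma> * measure lborel (cball (0::real^'n) 1) *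
    (\<Sum>i\<le>k. (2 powr (real CARD('n) - \<gamma>)) ^ i)"
proof (induction k)
  case 0
  have "J 1 \<le> (LINT x|lborel. indicator (cball (0::real^'n) 1) x)"
    unfolding J_def
  proof (rule integral_mono[OF integrable_japanese_powr_cball])
    show "integrable lborel (indicator (cball (0::real^'n) 1) :: _ \<Rightarrow> real)"
      by (rule integrable_real_indicator) (auto simp: emeasure_lborel_cball_finite[unfolded infinity_ennreal_def])
    show "indicator (cball 0 1) x * japanese x powr - \<gamma> \<le> indicator (cball 0 1) x" for x :: "real^'n"
      using japanese_powr_bounds[OF assms(1), of x] by (auto simp: indicator_def)
  qed
  also have "\<dots> \<le> 2 powr \<gamma> * measure lborel (cball (0::real^'n) 1)"
    using assms mult_right_mono[of 1 "2 powr \<gamma>" "measure lborel (cball (0::real^'n) 1)"]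
    by (simp add: ge_one_powr_ge_zero)
  finally show ?case by simp
next
  case (Suc k)
  let ?V = "measure lborel (cball (0::real^'n) 1)"
  have "(2 ^ k :: real) powr (- \<gamma>) * (2 * 2 ^ k) ^ CARD('n)
      = 2 powr \<gamma> * (2 powr (real CARD('n) - \<gamma>)) ^ Suc k"
  proof -
    have "(2 ^ k :: real) powr (- \<gamma>) = 2 powr (- \<gamma> * real k)"
      by (simp add: powr_powr mult.commute flip: powr_realpow)
    moreover have "(2 * 2 ^ k :: real) ^ CARD('n) = 2 powr (real CARD('n) * real (Suc k))"
      by (metis mult.commute of_nat_mult power_Suc power_mult powr_realpow zero_less_numeral)
    moreover have "(2 powr (real CARD('n) - \<gamma>)) ^ Suc k = (2::real) powr ((real CARD('n) - \<gamma>) * real (Suc k))"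
      by (metis powr_gt_zero powr_powr powr_realpow zero_neq_numeral)
    ultimately show ?thesis by (simp add: powr_add[symmetric] algebra_simps)
  qed
  then have "J (2 ^ Suc k) \<le> J (2 ^ k) + 2 powr \<gamma> * (2 powr (real CARD('n) - \<gamma>)) ^ Suc k * ?V"
    using japanese_powr_integral_step[OF assms(1), of "2 ^ k", where 'n='n] unfolding J_def by simp
  with Suc show ?case by (simp add: algebra_simps)
qed

text \<open>\<open>k\<close> is the rounded-up binary logarithm of \<open>L\<close>. Its first bound
  serves the growing geometric sum, the second one the case of ratio 1, where the number of terms is
  what counts.\<close>

lemma japanese_powr_integral_le_sum:
  fixes \<gamma> L :: real
  assumes "\<gamma> \<ge> 0" "1 \<le> L"
  obtains k :: nat where "2 ^ k \<le> 2 * L" "real k \<le> log 2 L + 1"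
    "(LINT x|lborel. indicator (cball (0::real^'n) L) x * japanese x powr (- \<gamma>))
      \<le> 2 powr \<gamma> * measure lborel (cball (0::real^'n) 1) * (\<Sum>i\<le>k. (2 powr (real CARD('n) - \<gamma>)) ^ i)"
proof -
  define k where "k = nat \<lceil>log 2 L\<rceil>"
  have l: "0 \<le> log 2 L" using assms by simp
  then have k: "log 2 L \<le> real k" "real k \<le> log 2 L + 1" by (auto simp: k_def)
  have "L = 2 powr log 2 L" using assms by simp
  also have "\<dots> \<le> 2 powr real k" using k by (intro powr_mono) auto
  finally have Lk: "L \<le> 2 ^ k" by (simp add: powr_realpow)
  have "2 powr real k \<le> 2 powr (log 2 L + 1)" using k by (intro powr_mono) auto
  then have kL: "2 ^ k \<le> 2 * L" using assms by (simp add: powr_realpow powr_add)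
  have "(LINT x|lborel. indicator (cball (0::real^'n) L) x * japanese x powr (- \<gamma>))
      \<le> (LINT x|lborel. indicator (cball (0::real^'n) (2 ^ k)) x * japanese x powr (- \<gamma>))"
    by (intro integral_mono integrable_japanese_powr_cball mult_right_mono)
      (use Lk in \<open>auto simp: indicator_def\<close>)
  also note japanese_powr_integral_dyadic[OF assms(1)]
  finally show ?thesis by (rule that[OF kL k(2)])
qed

text \<open>As \<open>\<gamma>\<close> is fixed, exactly one of the three guards holds, and
  \<open>M\<close> is taken from that case.\<close>

lemma japanese_powr_integral_bounds:
  fixes \<gamma> :: real
  assumes \<gamma>: "\<gamma> \<ge> 0"
  defines "J \<equiv> \<lambda>L. LINT x|lborel. indicator (cball (0::real^'n) L) x * japanese x powr (- \<gamma>)"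
  obtains M where "M > 0"
    "\<And>L. 1 \<le> L \<Longrightarrow> \<gamma> < real CARD('n) \<Longrightarrow> J L \<le> M * L powr (real CARD('n) - \<gamma>)"
    "\<And>L. 1 \<le> L \<Longrightarrow> \<gamma> = real CARD('n) \<Longrightarrow> J L \<le> M * (1 + ln L)"
    "\<And>L. 1 \<le> L \<Longrightarrow> \<gamma> > real CARD('n) \<Longrightarrow> J L \<le> M"
proof -
  define r where "r = 2 powr (real CARD('n) - \<gamma>)"
  define A where "A = 2 powr \<gamma> * measure lborel (cball (0::real^'n) 1)"
  have A: "A > 0" by (simp add: A_def)
  have r0: "r > 0" by (simp add: r_def)
  consider "\<gamma> < real CARD('n)" | "\<gamma> = real CARD('n)" | "\<gamma> > real CARD('n)" by linarith
  then show ?thesis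
  proof cases
    case 1
    then have r1: "r > 1" by (simp add: r_def)
    have "J L \<le> (A * (r * r / (r - 1))) * L powr (real CARD('n) - \<gamma>)" if L: "1 \<le> L" for L
    proof -
      obtain k where k: "2 ^ k \<le> 2 * L" "real k \<le> log 2 L + 1" "J L \<le> A * (\<Sum>i\<le>k. r ^ i)"
        unfolding J_def A_def r_def by (rule japanese_powr_integral_le_sum[OF \<gamma> L])
      have "r ^ k = (2 ^ k) powr (real CARD('n) - \<gamma>)"
        unfolding r_def by (simp add: powr_powr mult.commute flip: powr_realpow)
      also have "\<dots> \<le> (2 * L) powr (real CARD('n) - \<gamma>)"
        using k 1 by (intro powr_mono2) auto
      also have "\<dots> = r * L powr (real CARD('n) - \<gamma>)"
        using L by (simp add: powr_mult r_def)
      finally have rk: "r ^ k \<le> r * L powr (real CARD('n) - \<gamma>)" .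
      have "(\<Sum>i\<le>k. r ^ i) = (r ^ Suc k - 1) / (r - 1)"
        using geometric_sum[of r "Suc k"] r1 by (simp add: lessThan_Suc_atMost)
      also have "\<dots> \<le> r * r ^ k / (r - 1)"
        using r1 by (intro divide_right_mono) auto
      also have "\<dots> \<le> r * (r * L powr (real CARD('n) - \<gamma>)) / (r - 1)"
        using r1 rk by (intro divide_right_mono mult_left_mono) auto
      finally have "A * (\<Sum>i\<le>k. r ^ i) \<le> A * (r * (r * L powr (real CARD('n) - \<gamma>)) / (r - 1))"
        using A by (intro mult_left_mono) auto
      with k show ?thesis by (simp add: mult_ac)
    qed
    moreover have "A * (r * r / (r - 1)) > 0" using A r1 by simp
    ultimately show ?thesis using 1 by (intro that) auto
  next
    case 2
    have "J L \<le> (A * (2 + 1 / ln 2)) * (1 + ln L)" if L: "1 \<le> L" for L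
    proof -
      obtain k where k: "2 ^ k \<le> 2 * L" "real k \<le> log 2 L + 1" "J L \<le> A * (\<Sum>i\<le>k. r ^ i)"
        unfolding J_def A_def r_def by (rule japanese_powr_integral_le_sum[OF \<gamma> L])
      have "real (Suc k) \<le> 2 + 1 / ln 2 * ln L" using k(2) by (simp add: log_def)
      also have "\<dots> \<le> (2 + 1 / ln 2) * (1 + ln L)"
        unfolding distrib_left distrib_right using L by (simp add: add_nonneg_nonneg)
      finally have "A * real (Suc k) \<le> A * ((2 + 1 / ln 2) * (1 + ln L))" using A by simp
      moreover have "(\<Sum>i\<le>k. r ^ i) = real (Suc k)" using 2 by (simp add: r_def)
      ultimately show ?thesis using k(3) by (simp add: mult_ac)
    qed
    moreover have "A * (2 + 1 / ln 2) > 0" using A by (intro mult_pos_pos add_pos_pos) auto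
    ultimately show ?thesis using 2 by (intro that) auto
  next
    case 3
    then have r1: "r < 1" unfolding r_def using powr_less_mono[of "real CARD('n) - \<gamma>" 0 2] by simp
    have "J L \<le> A * (1 / (1 - r))" if L: "1 \<le> L" for L
    proof -
      obtain k where k: "2 ^ k \<le> 2 * L" "real k \<le> log 2 L + 1" "J L \<le> A * (\<Sum>i\<le>k. r ^ i)"
        unfolding J_def A_def r_def by (rule japanese_powr_integral_le_sum[OF \<gamma> L])
      have "(\<Sum>i\<le>k. r ^ i) = (1 - r ^ Suc k) / (1 - r)"
        using sum_gp_strict[of r "Suc k"] r1 by (simp add: lessThan_Suc_atMost)
      also have "\<dots> \<le> 1 / (1 - r)" using r0 r1 by (intro divide_right_mono) auto
      finally have "A * (\<Sum>i\<le>k. r ^ i) \<le> A * (1 / (1 - r))" using A by (intro mult_left_mono) auto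
      with k show ?thesis by simp
    qed
    moreover have "A * (1 / (1 - r)) > 0" using A r1 by simp
    ultimately show ?thesis using 3 by (intro that) auto
  qed
qed

section \<open>The test function\<close>

text \<open>Young's inequality for the factors \<open>u * (g * e) powr (1 / p)\<close> and
  \<open>b * g powr (- 1 / p)\<close>; the exponent \<open>- 1 / (p - 1)\<close> is
  \<open>- q / p\<close>. The factors \<open>1 / p\<close> and \<open>1 / q\<close> are dropped:
  coefficient 1 in front of \<open>u powr p\<close> is just small enough for the absorption.\<close>

lemma weighted_Young:
  fixes p q g e u b :: real
  assumes p: "1 < p" and q: "q = p / (p - 1)" and "0 < g" "0 \<le> e" "0 \<le> u" "0 \<le> b"
  shows "u * (e powr (1 / p) * b) \<le> u powr p * (g * e) + b powr q * g powr (- 1 / (p - 1))"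
proof -
  have q1: "q > 1" and pq: "1 / p + 1 / q = 1" using p by (auto simp: q field_simps)
  have div_le: "y / r \<le> y" if "0 \<le> y" "1 < r" for y r :: real
    using divide_left_mono[of 1 r y] that by simp
  define a d where "a = u * (g * e) powr (1 / p)" and "d = b * g powr (- 1 / p)"
  have "u * (e powr (1 / p) * b) = a * d"
    using assms by (simp add: a_def d_def powr_mult powr_minus_divide field_simps)
  also have "\<dots> \<le> a powr p / p + d powr q / q"
    using assms by (intro Youngs_inequality q1 pq) (auto simp: a_def d_def)
  also have "\<dots> \<le> a powr p + d powr q"
    using p q1 by (intro add_mono div_le) auto
  also have "a powr p = u powr p * (g * e)"
    using assms by (simp add: a_def powr_mult powr_powr)
  also have "d powr q = b powr q * g powr (- 1 / (p - 1))"
    using assms by (simp add: d_def powr_mult powr_powr)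
  finally show ?thesis .
qed

lemma powr_add_le:
  fixes a b q :: real
  assumes "0 \<le> a" "0 \<le> b" "0 \<le> q"
  shows "(a + b) powr q \<le> 2 powr q * (a powr q + b powr q)"
proof -
  have "(a + b) powr q \<le> (2 * max a b) powr q"
    using assms by (intro powr_mono2) auto
  also have "\<dots> = 2 powr q * max a b powr q"
    using assms by (simp add: powr_mult)
  also have "\<dots> \<le> 2 powr q * (a powr q + b powr q)"
    using assms by (intro mult_left_mono) (auto simp: max_def)
  finally show ?thesis .
qed

text \<open>On the times where the time cutoff varies, \<open>(1 + t) powr \<beta>\<close> may be
  replaced by \<open>R powr \<beta>\<close>. The bounds \<open>R / 2 \<le> 1 + t\<close> and
  \<open>1 + t \<le> 2 * R\<close> serve the two signs of \<open>\<beta>\<close>.\<close>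

lemma shifted_powr_ge:
  fixes \<beta> R t :: real
  assumes "-1 < \<beta>" "\<beta> < 1" "1 \<le> R" "R / 2 \<le> t" "t \<le> R"
  shows "R powr \<beta> / 2 \<le> (1 + t) powr \<beta>"
proof (cases "\<beta> \<ge> 0")
  case True
  have "R powr \<beta> / 2 \<le> R powr \<beta> / 2 powr \<beta>"
    using powr_mono[of \<beta> 1 "2::real"] assms by (intro divide_left_mono) auto
  also have "\<dots> = (R / 2) powr \<beta>" using assms by (simp add: powr_divide)
  also have "\<dots> \<le> (1 + t) powr \<beta>" using assms True by (intro powr_mono2) auto
  finally show ?thesis .
next
  case False
  have "2 powr (-1) \<le> (2::real) powr \<beta>" using assms by (intro powr_mono) auto
  then have "R powr \<beta> / 2 \<le> 2 powr \<beta> * R powr \<beta>"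
    using mult_right_mono[of "1/2" "2 powr \<beta>" "R powr \<beta>"] by (simp add: powr_minus)
  also have "\<dots> = (2 * R) powr \<beta>" using assms by (simp add: powr_mult)
  also have "\<dots> \<le> (1 + t) powr \<beta>" using assms False by (intro powr_mono2') auto
  finally show ?thesis .
qed

text \<open>Weight and cutoff are fixed once, independently of the solution, of \<epsilon> and of
  \<open>R\<close>, so that every constant built from \<open>c\<close>, \<open>C\<close> and
  \<open>D\<close> is uniform in these.\<close>

locale blowup_test_function =
  fixes \<alpha> \<beta> p q c C D :: real and g w H :: "real \<Rightarrow> real"
  assumes \<alpha>: "0 \<le> \<alpha>" and \<beta>: "-1 < \<beta>" "\<beta> < 1" and \<alpha>\<beta>: "\<alpha> * \<beta> = 0"
    and p: "1 < p" and q: "q = p / (p - 1)"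
    and g: "smooth g" and w: "smooth w" and c: "c > 0" and C: "C > 0"
    and w_eq: "\<And>t. t > -1/2 \<Longrightarrow> w t = (1 + t) powr (- \<beta>)"
    and ode: "\<And>t. (g has_real_derivative w t * g t - 1) (at t)"
    and g0: "g 0 = inverse (B_const \<beta>)"
    and g_ge: "\<And>t. t \<ge> 0 \<Longrightarrow> c * (1 + t) powr \<beta> \<le> g t"
    and g_le: "\<And>t. t \<ge> 0 \<Longrightarrow> g t \<le> C * (1 + t) powr \<beta>"
    and g_1: "\<beta> = 0 \<Longrightarrow> (\<And>t. t \<ge> 0 \<Longrightarrow> g t = 1)"
    and H: "smooth H" "\<And>s. 0 \<le> H s" "\<And>s. H s \<le> 1" and D: "D > 0"
    and H_1: "\<And>s. s \<le> 1/2 \<Longrightarrow> H s = 1" and H_0: "\<And>s. s \<ge> 1 \<Longrightarrow> H s = 0"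
    and H'_0: "\<And>s. s < 1/2 \<Longrightarrow> dir_deriv 1 H s = 0"
    and H': "\<And>s. \<bar>dir_deriv 1 H s\<bar> \<le> D * H s powr (1 / p)"
    and H'': "\<And>s. \<bar>dir_deriv 1 (dir_deriv 1 H) s\<bar> \<le> D * H s powr (1 / p)"
begin

section \<open>The rescaled cutoffs and the adjoint operator on the test function\<close>

definition time_cut :: "real \<Rightarrow> real \<Rightarrow> real" where
  "time_cut R t = H (1 / R * t)"

definition space_cut :: "real \<Rightarrow> 'a::euclidean_space \<Rightarrow> real" where
  "space_cut L x = H (1 / L\<^sup>2 * (x \<bullet> x))"

definition test :: "real \<Rightarrow> real \<Rightarrow> real \<times> (real^'n) \<Rightarrow> real" where
  "test R L = (\<lambda>z. (g (fst z) * time_cut R (fst z)) * space_cut L (snd z))"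

definition adjoint_op :: "real \<Rightarrow> real \<Rightarrow> real \<times> (real^'n) \<Rightarrow> real" where
  "adjoint_op R L z = dt (dt (test R L)) z - laplace_x (test R L) z
     - dt (\<lambda>z. damping \<alpha> \<beta> z * test R L z) z"

lemma g_pos: "t \<ge> 0 \<Longrightarrow> g t > 0"
  using g_ge[of t] c by (smt (verit) mult_pos_pos powr_gt_zero)

lemma smooth_time_cut: "smooth (time_cut R)"
  unfolding time_cut_def[abs_def]
  by (rule smooth_compose[OF H(1)])
    (intro smooth_mult smooth_const smooth_bounded_linear bounded_linear_ident)

lemma smooth_space_cut: "smooth (space_cut L)"
  unfolding space_cut_def[abs_def] by (rule smooth_radial[OF H(1)])

lemma cut_bounds: "0 \<le> time_cut R t" "time_cut R t \<le> 1" "0 \<le> space_cut L x" "space_cut L x \<le> 1"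
  by (simp_all add: time_cut_def space_cut_def H)

text \<open>Applied to the cutoff factor that is not differentiated, so that the product of both
  cutoffs appears to the same power \<open>1 / p\<close>.\<close>

lemma le_powr_inverse_p: "0 \<le> y \<Longrightarrow> y \<le> 1 \<Longrightarrow> y \<le> y powr (1 / p)"
  using p powr_mono'[of "1 / p" 1 y] by simp

lemma dir_deriv_time_cut:
  "dir_deriv 1 (time_cut R) = (\<lambda>t. dir_deriv 1 H (1 / R * t) * (1 / R))"
  "dir_deriv 1 (dir_deriv 1 (time_cut R)) = (\<lambda>t. dir_deriv 1 (dir_deriv 1 H) (1 / R * t) * (1 / R\<^sup>2))"
proof -
  have chain: "((\<lambda>t. F (1 / R * t)) has_real_derivative dir_deriv 1 F (1 / R * t) * (1 / R)) (at t)"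
    if "smooth F" for F t
    by (rule DERIV_chain2[OF smooth_DERIV[OF that] DERIV_cmult_Id])
  show eq: "dir_deriv 1 (time_cut R) = (\<lambda>t. dir_deriv 1 H (1 / R * t) * (1 / R))"
    unfolding time_cut_def[abs_def] by (rule ext, rule dir_deriv_eq_DERIV, rule chain[OF H(1)])
  show "dir_deriv 1 (dir_deriv 1 (time_cut R)) = (\<lambda>t. dir_deriv 1 (dir_deriv 1 H) (1 / R * t) * (1 / R\<^sup>2))"
    unfolding eq
    using DERIV_cmult_right[OF chain[OF smooth_dir_deriv_1[OF H(1)]], of "1 / R"]
    by (intro ext dir_deriv_eq_DERIV) (simp add: power2_eq_square)
qed

text \<open>Only the first bound records the support. Its term will be multiplied by a negative
  power of \<open>g\<close>, which needs \<open>g\<close> bounded below by a multiple of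
  \<open>R powr \<beta>\<close>; the second derivative comes with a factor \<open>g\<close> that
  outweighs this negative power.\<close>

lemma time_cut_derivative_bounds:
  assumes "R > 0"
  shows "\<bar>dir_deriv 1 (time_cut R) t\<bar> \<le> D * time_cut R t powr (1 / p) * (1 / R) * indicator {R/2..} t"
    and "\<bar>dir_deriv 1 (dir_deriv 1 (time_cut R)) t\<bar> \<le> D * time_cut R t powr (1 / p) * (1 / R\<^sup>2)"
proof -
  have "dir_deriv 1 H (1 / R * t) = 0" if "t < R / 2"
    using that assms by (intro H'_0) (simp add: field_simps)
  moreover have "\<bar>dir_deriv 1 H (1 / R * t) * (1 / R)\<bar> \<le> D * H (1 / R * t) powr (1 / p) * (1 / R)"
    using assms D by (simp only: abs_mult) (intro mult_mono H', auto)
  ultimately show "\<bar>dir_deriv 1 (time_cut R) t\<bar> \<le> D * time_cut R t powr (1 / p) * (1 / R) * indicator {R/2..} t"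
    by (auto simp: dir_deriv_time_cut time_cut_def indicator_def)
  have "\<bar>dir_deriv 1 (dir_deriv 1 H) (1 / R * t) * (1 / R\<^sup>2)\<bar> \<le> D * H (1 / R * t) powr (1 / p) * (1 / R\<^sup>2)"
    using assms D by (simp only: abs_mult) (intro mult_mono H'', auto)
  then show "\<bar>dir_deriv 1 (dir_deriv 1 (time_cut R)) t\<bar> \<le> D * time_cut R t powr (1 / p) * (1 / R\<^sup>2)"
    unfolding dir_deriv_time_cut(2) time_cut_def .
qed

lemma laplacian_space_cut_bound:
  fixes x :: "real^'n"
  assumes "L > 0"
  shows "\<bar>\<Sum>i\<in>UNIV. dir_deriv (axis i 1) (dir_deriv (axis i 1) (space_cut L)) x\<bar>
    \<le> D * (4 + 2 * real CARD('n)) * (1 / L\<^sup>2) * space_cut L x powr (1 / p)"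
proof -
  define y where "y = 1 / L\<^sup>2 * (x \<bullet> x)"
  define E where "E = D * H y powr (1 / p)"
  have H1: "\<bar>dir_deriv 1 H y\<bar> \<le> E" and H2: "\<bar>dir_deriv 1 (dir_deriv 1 H) y\<bar> \<le> E"
    unfolding E_def by (rule H' H'')+
  have y0: "y \<ge> 0" by (simp add: y_def)
  \<comment> \<open>The factor \<open>y\<close> is harmless: for \<open>y > 1\<close> the cutoff
    vanishes, hence \<open>E\<close> does, and \<open>H2\<close> forces the second derivative to be
    0.\<close>
  have "y * \<bar>dir_deriv 1 (dir_deriv 1 H) y\<bar> \<le> E"
  proof (cases "y \<le> 1")
    case True
    then show ?thesis
      using mult_mono[OF True H2] y0 by simp
  next
    case False
    then have "E = 0" using H_0[of y] p by (simp add: E_def)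
    with H2 show ?thesis by simp
  qed
  then have A: "\<bar>4 * (1 / L\<^sup>2) * (y * dir_deriv 1 (dir_deriv 1 H) y)\<bar> \<le> 4 * (1 / L\<^sup>2) * E"
    using y0 by (simp only: abs_mult) (auto intro!: mult_left_mono divide_right_mono)
  have B: "\<bar>2 * real CARD('n) * (1 / L\<^sup>2) * dir_deriv 1 H y\<bar> \<le> 2 * real CARD('n) * (1 / L\<^sup>2) * E"
    unfolding abs_mult using H1 by (intro mult_mono) auto
  have "(\<Sum>i\<in>UNIV. dir_deriv (axis i 1) (dir_deriv (axis i 1) (space_cut L)) x)
      = 4 * (1 / L\<^sup>2) * (y * dir_deriv 1 (dir_deriv 1 H) y) + 2 * real CARD('n) * (1 / L\<^sup>2) * dir_deriv 1 H y"
    unfolding space_cut_def[abs_def] laplacian_radial[OF H(1)] y_def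
    by (simp add: power2_eq_square algebra_simps)
  also have "\<bar>\<dots>\<bar> \<le> 4 * (1 / L\<^sup>2) * E + 2 * real CARD('n) * (1 / L\<^sup>2) * E"
    using A B by linarith
  also have "\<dots> = D * (4 + 2 * real CARD('n)) * (1 / L\<^sup>2) * space_cut L x powr (1 / p)"
    by (simp add: E_def y_def space_cut_def algebra_simps)
  finally show ?thesis .
qed

lemma adjoint_op_eq:
  fixes x :: "real^'n"
  assumes "t \<ge> 0"
  shows "adjoint_op R L (t, x) = space_cut L x *
      (dir_deriv 1 (dir_deriv 1 (\<lambda>t. g t * time_cut R t)) t
        - japanese x powr (- \<alpha>) * dir_deriv 1 (\<lambda>t. w t * (g t * time_cut R t)) t)
    - g t * time_cut R t * (\<Sum>i\<in>UNIV. dir_deriv (axis i 1) (dir_deriv (axis i 1) (space_cut L)) x)"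
proof -
  have a: "smooth (\<lambda>t. g t * time_cut R t)"
    by (intro smooth_mult g smooth_time_cut)
  note a' = smooth_dir_deriv_1[OF a]
  note k = smooth_space_cut[of L, where 'a="real^'n"]
  show ?thesis
    using dt_damping_product[OF a k w w_eq assms, of \<alpha> x]
    unfolding adjoint_op_def test_def dt_product[OF a k] dt_product[OF a' k] laplace_x_product[OF a k]
    by (simp add: right_diff_distrib mult_ac)
qed

text \<open>The hypothesis \<open>L \<le> R\<close> lets the term with 1/R^2 be absorbed into the
  one with 1/L^2. The constant is the sum of \<open>C + 2\<close> from the first time derivative, 1
  from the second, and \<open>4 + 2 * real CARD('n)\<close> from the Laplacian.\<close>

lemma adjoint_op_bound:
  fixes x :: "real^'n"
  assumes R: "R > 0" and L: "L > 0" "L \<le> R" and t: "t \<ge> 0"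
  defines "j \<equiv> japanese x powr (- \<alpha>)"
  shows "\<bar>adjoint_op R L (t, x)\<bar> \<le> D * (C + 7 + 2 * real CARD('n)) *
    ((time_cut R t * space_cut L x) powr (1 / p) * (indicator {R/2..} t * (j / R) + g t / L\<^sup>2))"
proof -
  define e k i where "e = time_cut R t" and "k = space_cut L x" and "i = (indicator {R/2..} t :: real)"
  have b: "0 \<le> e" "e \<le> 1" "0 \<le> k" "k \<le> 1" using cut_bounds by (auto simp: e_def k_def)
  have i: "0 \<le> i" by (simp add: i_def)
  have gt: "g t > 0" using g_pos t by simp
  have j: "0 < j" "j \<le> 1" unfolding j_def using japanese_powr_bounds[OF \<alpha>] by auto
  \<comment> \<open>If \<open>\<beta> \<noteq> 0\<close>, then \<open>\<alpha> = 0\<close> and the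
    spatial weight is constant.\<close>
  have \<beta>j: "\<beta> = 0 \<or> j = 1"
    using \<alpha>\<beta> by (auto simp: j_def japanese_def) (simp add: add_pos_nonneg less_imp_neq[symmetric])
  have RL: "1 / R\<^sup>2 \<le> 1 / L\<^sup>2"
    using R L by (intro divide_left_mono power_mono) auto
  define Y where "Y = (e * k) powr (1 / p)"
  have Y: "Y = e powr (1 / p) * k powr (1 / p)" using b by (simp add: Y_def powr_mult)
  have Yb: "k * e powr (1 / p) \<le> Y" "e * k powr (1 / p) \<le> Y"
    unfolding Y using mult_right_mono[OF le_powr_inverse_p[OF b(3,4)], of "e powr (1 / p)"]
      mult_right_mono[OF le_powr_inverse_p[OF b(1,2)], of "k powr (1 / p)"]
    by (simp_all add: mult.commute)
  have Y0: "0 \<le> Y" by (simp add: Y_def)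
  define T1 where "T1 = dir_deriv 1 (dir_deriv 1 (\<lambda>t. g t * time_cut R t)) t
        - j * dir_deriv 1 (\<lambda>t. w t * (g t * time_cut R t)) t"
  define T2 where "T2 = (\<Sum>i\<in>UNIV. dir_deriv (axis i 1) (dir_deriv (axis i 1) (space_cut L)) x)"
  have "\<bar>T1\<bar> \<le> g t * \<bar>dir_deriv 1 (dir_deriv 1 (time_cut R)) t\<bar> + (C + 2) * j * \<bar>dir_deriv 1 (time_cut R) t\<bar>"
    unfolding T1_def
    by (rule time_factor_bound[OF g w smooth_time_cut w_eq ode])
      (use g_pos[THEN less_imp_le] g_le g_1 \<beta>j j t C in auto)
  also have "\<dots> \<le> g t * (D * e powr (1 / p) * (1 / R\<^sup>2)) + (C + 2) * j * (D * e powr (1 / p) * (1 / R) * i)"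
    unfolding e_def i_def using time_cut_derivative_bounds[OF R] gt j C
    by (intro add_mono mult_left_mono) auto
  also have "\<dots> \<le> g t * (D * e powr (1 / p) * (1 / L\<^sup>2)) + (C + 2) * j * (D * e powr (1 / p) * (1 / R) * i)"
    using gt D RL by (intro add_mono mult_left_mono order_refl) auto
  also have "\<dots> = D * e powr (1 / p) * (g t / L\<^sup>2 + (C + 2) * (i * (j / R)))"
    by (simp add: algebra_simps)
  finally have T1: "\<bar>T1\<bar> \<le> D * e powr (1 / p) * (g t / L\<^sup>2 + (C + 2) * (i * (j / R)))" .
  have pos: "0 \<le> g t / L\<^sup>2" "0 \<le> i * (j / R)" using gt j i R by auto
  have "\<bar>k * T1\<bar> \<le> k * (D * e powr (1 / p) * (g t / L\<^sup>2 + (C + 2) * (i * (j / R))))"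
    using T1 b by (simp add: abs_mult mult_left_mono)
  also have "\<dots> = (k * e powr (1 / p)) * (D * (g t / L\<^sup>2 + (C + 2) * (i * (j / R))))"
    by (simp add: algebra_simps)
  also have "\<dots> \<le> Y * (D * (g t / L\<^sup>2 + (C + 2) * (i * (j / R))))"
    using D C i j gt R
    by (intro mult_right_mono[OF Yb(1)] mult_nonneg_nonneg add_nonneg_nonneg) auto
  finally have P1: "\<bar>k * T1\<bar> \<le> Y * (D * (g t / L\<^sup>2 + (C + 2) * (i * (j / R))))" .
  have "\<bar>T2\<bar> \<le> D * (4 + 2 * real CARD('n)) * (1 / L\<^sup>2) * k powr (1 / p)"
    unfolding T2_def k_def by (rule laplacian_space_cut_bound[OF L(1)])
  then have "\<bar>g t * e * T2\<bar> \<le> g t * e * (D * (4 + 2 * real CARD('n)) * (1 / L\<^sup>2) * k powr (1 / p))"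
    using gt b by (simp only: abs_mult) (intro mult_mono, auto)
  also have "\<dots> = (e * k powr (1 / p)) * (D * ((4 + 2 * real CARD('n)) * (g t / L\<^sup>2)))"
    by (simp add: algebra_simps)
  also have "\<dots> \<le> Y * (D * ((4 + 2 * real CARD('n)) * (g t / L\<^sup>2)))"
    using D gt
    by (intro mult_right_mono[OF Yb(2)] mult_nonneg_nonneg add_nonneg_nonneg) auto
  finally have P2: "\<bar>g t * e * T2\<bar> \<le> Y * (D * ((4 + 2 * real CARD('n)) * (g t / L\<^sup>2)))" .
  have "\<bar>adjoint_op R L (t, x)\<bar> \<le> \<bar>k * T1\<bar> + \<bar>g t * e * T2\<bar>"
    unfolding adjoint_op_eq[OF t] T1_def T2_def j_def k_def e_def by (rule abs_triangle_ineq4)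
  also have "\<dots> \<le> Y * (D * (g t / L\<^sup>2 + (C + 2) * (i * (j / R))))
      + Y * (D * ((4 + 2 * real CARD('n)) * (g t / L\<^sup>2)))"
    using P1 P2 by (rule add_mono)
  also have "\<dots> = Y * (D * ((5 + 2 * real CARD('n)) * (g t / L\<^sup>2) + (C + 2) * (i * (j / R))))"
    by (simp add: algebra_simps)
  also have "\<dots> \<le> Y * (D * ((C + 7 + 2 * real CARD('n)) * (g t / L\<^sup>2) + (C + 7 + 2 * real CARD('n)) * (i * (j / R))))"
    using Y0 D C pos by (intro mult_left_mono add_mono mult_right_mono) auto
  also have "\<dots> = D * (C + 7 + 2 * real CARD('n)) * (Y * (i * (j / R) + g t / L\<^sup>2))"
    by (simp only: distrib_left distrib_right mult_ac add_ac)
  finally show ?thesis by (simp only: Y_def e_def k_def i_def)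
qed

text \<open>What Young's inequality leaves, up to constants. In the first summand \<open>- q\<close>
  comes from the factor \<open>1 / R\<close> and \<open>- \<beta> / (p - 1)\<close> from the power
  of \<open>g\<close>; in the second the powers of \<open>g\<close> combine to \<open>g\<close>
  itself. Each summand is a function of \<open>t\<close> times a function of \<open>x\<close>, so
  its integral factorises.\<close>

definition majorant :: "real \<Rightarrow> real \<Rightarrow> real \<times> (real^'n) \<Rightarrow> real" where
  "majorant R L = (\<lambda>z.
     (indicator {R/2..R} (fst z) * R powr (- \<beta> / (p - 1) - q))
       * (indicator (cball 0 L) (snd z) * japanese (snd z) powr (- (\<alpha> * q)))
     + (indicator {0..R} (fst z) * (1 + fst z) powr \<beta>)
       * (L powr (- (2 * q)) * indicator (cball 0 L) (snd z)))"

text \<open>The factor 2 stems from \<open>powr_add_le\<close>, the power of \<open>c / 2\<close>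
  from the lower bound of \<open>g\<close> on \<open>[R/2, R]\<close>, and the summand
  \<open>C\<close> from its upper bound.\<close>

definition Young_const :: "nat \<Rightarrow> real" where
  "Young_const n = (2 * (D * (C + 7 + 2 * real n))) powr q * ((c / 2) powr (- 1 / (p - 1)) + C)"

lemma Young_const_nonneg: "0 \<le> Young_const n"
  using C by (simp add: Young_const_def)

lemma cuts_vanish:
  assumes "R > 0" "L > 0" "t > R \<or> x \<notin> cball 0 L"
  shows "time_cut R t * space_cut L x = 0"
proof -
  have "time_cut R t = 0" if "t > R"
    using that assms unfolding time_cut_def by (intro H_0) (simp add: field_simps)
  moreover have "space_cut L x = 0" if "x \<notin> cball 0 L"
  proof -
    have "L\<^sup>2 \<le> (norm x)\<^sup>2" using that assms by (intro power_mono) auto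
    then show ?thesis
      using assms unfolding space_cut_def by (intro H_0) (simp add: power2_norm_eq_inner)
  qed
  ultimately show ?thesis using assms by auto
qed

lemma majorant_nonneg: "0 \<le> majorant R L z"
  by (auto simp: majorant_def intro!: add_nonneg_nonneg)

text \<open>The absorption in pointwise form. For \<open>v = u t x\<close> the first term on the
  right is the nonlinear integrand of the weak formulation.\<close>

lemma adjoint_op_Young:
  fixes x :: "real^'n"
  assumes R: "R \<ge> 1" and L: "L > 0" "L \<le> R" and t: "t \<ge> 0"
  shows "v * adjoint_op R L (t, x)
    \<le> \<bar>v\<bar> powr p * test R L (t, x) + Young_const CARD('n) * majorant R L (t, x)"
proof -
  define M where "M = D * (C + 7 + 2 * real CARD('n))"
  define j where "j = japanese x powr (- \<alpha>)"
  define e where "e = time_cut R t * space_cut L x"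
  define b1 where "b1 = indicator {R/2..} t * (j / R)"
  have R0: "R > 0" using R by simp
  have M: "M > 0" using D C by (simp add: M_def)
  have gt: "g t > 0" by (rule g_pos[OF t])
  have e: "0 \<le> e" unfolding e_def by (intro mult_nonneg_nonneg cut_bounds)
  have j: "0 < j" unfolding j_def by (rule japanese_powr_bounds[OF \<alpha>])
  have q0: "q > 0" using p by (simp add: q)
  have test: "test R L (t, x) = g t * e" by (simp add: test_def e_def)
  have "v * adjoint_op R L (t, x) \<le> \<bar>v\<bar> * \<bar>adjoint_op R L (t, x)\<bar>"
    by (metis abs_ge_self abs_mult)
  also have "\<dots> \<le> \<bar>v\<bar> * (M * (e powr (1 / p) * (b1 + g t / L\<^sup>2)))"
    using adjoint_op_bound[OF R0 L t, of x]
    by (intro mult_left_mono) (simp_all add: M_def e_def b1_def j_def)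
  also have "\<dots> = \<bar>v\<bar> * (e powr (1 / p) * (M * (b1 + g t / L\<^sup>2)))"
    by (simp add: mult_ac)
  finally have main: "v * adjoint_op R L (t, x) \<le> \<bar>v\<bar> * (e powr (1 / p) * (M * (b1 + g t / L\<^sup>2)))" .
  show ?thesis
  proof (cases "t > R \<or> x \<notin> cball 0 L")
    case True
    then have "e = 0" using cuts_vanish[OF R0 L(1)] by (simp add: e_def)
    with main p have "v * adjoint_op R L (t, x) \<le> 0" by simp
    moreover have "0 \<le> Young_const CARD('n) * majorant R L (t, x)"
      by (intro mult_nonneg_nonneg Young_const_nonneg majorant_nonneg)
    ultimately show ?thesis using test \<open>e = 0\<close> by simp
  next
    case False
    then have in_supp: "t \<le> R" "x \<in> cball 0 L" by auto
    define G where "G = g t powr (- 1 / (p - 1))"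
    have G: "G > 0" using gt by (simp add: G_def)
    have b1: "0 \<le> b1" and b2: "0 \<le> g t / L\<^sup>2"
      using j R gt by (auto simp: b1_def)
    have "(M * (b1 + g t / L\<^sup>2)) powr q \<le> M powr q * (2 powr q * (b1 powr q + (g t / L\<^sup>2) powr q))"
      using M b1 b2 q0 by (simp add: powr_mult mult_left_mono powr_add_le del: times_divide_eq_right)
    also have "\<dots> = (2 * M) powr q * (b1 powr q + (g t / L\<^sup>2) powr q)"
      using M by (simp add: powr_mult)
    finally have Mb: "(M * (b1 + g t / L\<^sup>2)) powr q * G
        \<le> (2 * M) powr q * (b1 powr q * G + (g t / L\<^sup>2) powr q * G)"
      unfolding distrib_right[symmetric] mult.assoc[symmetric]
      by (rule mult_right_mono[OF _ less_imp_le[OF G]])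
    have B1: "b1 powr q * G \<le> (c / 2) powr (- 1 / (p - 1)) *
        (indicator {R/2..R} t * R powr (- \<beta> / (p - 1) - q) * japanese x powr (- (\<alpha> * q)))"
    proof (cases "R / 2 \<le> t")
      case True
      have "c / 2 * R powr \<beta> \<le> c * (1 + t) powr \<beta>"
        using shifted_powr_ge[OF \<beta> R True in_supp(1)] c by (simp add: mult_left_mono field_simps)
      also have "\<dots> \<le> g t" by (rule g_ge[OF t])
      finally have "G \<le> (c / 2 * R powr \<beta>) powr (- 1 / (p - 1))"
        unfolding G_def using c R p by (intro powr_mono2') auto
      also have "\<dots> = (c / 2) powr (- 1 / (p - 1)) * R powr (- \<beta> / (p - 1))"
        using c by (subst powr_mult) (simp_all add: powr_powr)
      finally have "b1 powr q * G \<le> (j / R) powr q * ((c / 2) powr (- 1 / (p - 1)) * R powr (- \<beta> / (p - 1)))"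
        using True by (simp add: b1_def mult_left_mono)
      also have "(j / R) powr q = j powr q * R powr (- q)"
        using j R by (simp add: powr_divide powr_minus_divide)
      also have "j powr q = japanese x powr (- (\<alpha> * q))"
        by (simp add: j_def powr_powr)
      finally show ?thesis
        using True in_supp R powr_add[of R "- \<beta> / (p - 1)" "- q"] by (simp add: mult_ac)
    next
      case False
      then have "b1 = 0" by (simp add: b1_def)
      with q0 c show ?thesis by simp
    qed
    have "(g t / L\<^sup>2) powr q * G = g t powr (q - 1 / (p - 1)) * L powr (- (2 * q))"
    proof -
      have "(L\<^sup>2) powr q = L powr (2 * q)"
        using powr_powr[of L 2 q] L by simp
      then have "(g t / L\<^sup>2) powr q = g t powr q * L powr (- (2 * q))"
        using gt L by (simp add: powr_divide powr_minus_divide)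
      then show ?thesis using gt by (simp add: G_def powr_diff powr_minus divide_inverse mult_ac)
    qed
    \<comment> \<open>The powers of \<open>g\<close> leave exactly one factor \<open>g\<close>, so
      its upper bound suffices here.\<close>
    also have "q - 1 / (p - 1) = 1" using p by (simp add: q diff_divide_distrib[symmetric])
    also have "g t powr 1 * L powr (- (2 * q)) \<le> (C * (1 + t) powr \<beta>) * L powr (- (2 * q))"
      using gt g_le[OF t] by (intro mult_right_mono) auto
    finally have B2: "(g t / L\<^sup>2) powr q * G \<le> C * ((1 + t) powr \<beta> * L powr (- (2 * q)))"
      by (simp add: mult_ac)
    define m1 m2 where "m1 = indicator {R/2..R} t * R powr (- \<beta> / (p - 1) - q) * japanese x powr (- (\<alpha> * q))"
      and "m2 = (1 + t) powr \<beta> * L powr (- (2 * q))"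
    have m: "0 \<le> m1" "0 \<le> m2" by (auto simp: m1_def m2_def)
    have maj: "majorant R L (t, x) = m1 + m2"
      using in_supp t by (simp add: majorant_def m1_def m2_def)
    have "b1 powr q * G + (g t / L\<^sup>2) powr q * G \<le> (c / 2) powr (- 1 / (p - 1)) * m1 + C * m2"
      using B1 B2 unfolding m1_def m2_def by (rule add_mono)
    also have "\<dots> \<le> ((c / 2) powr (- 1 / (p - 1)) + C) * (m1 + m2)"
      using m C mult_nonneg_nonneg[of C m1] mult_nonneg_nonneg[of "(c / 2) powr (- 1 / (p - 1))" m2]
      by (simp only: distrib_left distrib_right) simp
    finally have "(2 * M) powr q * (b1 powr q * G + (g t / L\<^sup>2) powr q * G)
        \<le> Young_const CARD('n) * majorant R L (t, x)"
      unfolding Young_const_def maj M_def[symmetric] by (simp only: mult.assoc) (intro mult_left_mono, auto)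
    with Mb have K: "(M * (b1 + g t / L\<^sup>2)) powr q * G \<le> Young_const CARD('n) * majorant R L (t, x)"
      by (rule order_trans)
    note main
    also have "\<bar>v\<bar> * (e powr (1 / p) * (M * (b1 + g t / L\<^sup>2)))
        \<le> \<bar>v\<bar> powr p * (g t * e) + (M * (b1 + g t / L\<^sup>2)) powr q * G"
      unfolding G_def using M b1 b2 by (intro weighted_Young p q gt e) auto
    also have "\<dots> \<le> \<bar>v\<bar> powr p * (g t * e) + Young_const CARD('n) * majorant R L (t, x)"
      by (rule add_left_mono[OF K])
    finally show ?thesis unfolding test .
  qed
qed

end

section \<open>Integration of the test function inequality\<close>

lemma lborel_product_integral:
  fixes a :: "'a::euclidean_space \<Rightarrow> real" and b :: "'b::euclidean_space \<Rightarrow> real"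
  assumes a: "integrable lborel a" and b: "integrable lborel b"
  shows lborel_product_integrable: "integrable lborel (\<lambda>z. a (fst z) * b (snd z))"
    and "(LINT z|lborel. a (fst z) * b (snd z)) = (LINT t|lborel. a t) * (LINT x|lborel. b x)"
proof -
  have [measurable]: "a \<in> borel_measurable borel" "b \<in> borel_measurable borel"
    using a b by auto
  have int: "integrable (lborel \<Otimes>\<^sub>M lborel) (\<lambda>z. a (fst z) * b (snd z))"
  proof (rule lborel_pair.Fubini_integrable)
    show "(\<lambda>z. a (fst z) * b (snd z)) \<in> borel_measurable (lborel \<Otimes>\<^sub>M lborel)"
      by measurable
    have "integrable lborel (\<lambda>t. \<bar>a t\<bar> * (LINT x|lborel. \<bar>b x\<bar>))"
      using a by simp
    then show "integrable lborel (\<lambda>t. LINT x|lborel. norm (a (fst (t, x)) * b (snd (t, x))))"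
      by (simp add: abs_mult)
    show "AE t in lborel. integrable lborel (\<lambda>x. a (fst (t, x)) * b (snd (t, x)))"
      using b by simp
  qed
  then show "integrable lborel (\<lambda>z. a (fst z) * b (snd z))" by (simp add: lborel_prod)
  show "(LINT z|lborel. a (fst z) * b (snd z)) = (LINT t|lborel. a t) * (LINT x|lborel. b x)"
    using lborel_pair.integral_fst'[OF int] by (simp add: lborel_prod)
qed

lemma shifted_powr_integral:
  fixes \<beta> R :: real
  assumes "-1 < \<beta>" "0 \<le> R"
  shows "integrable lborel (\<lambda>t. indicator {0..R} t * (1 + t) powr \<beta>)"
    and "(LINT t|lborel. indicator {0..R} t * (1 + t) powr \<beta>) = ((1 + R) powr (1 + \<beta>) - 1) / (1 + \<beta>)"
proof -
  have "has_bochner_integral lborel (\<lambda>t. (1 + t) powr \<beta> * indicator {0..R} t)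
    ((1 + R) powr (1 + \<beta>) / (1 + \<beta>) - (1 + 0) powr (1 + \<beta>) / (1 + \<beta>))"
  proof (rule has_bochner_integral_FTC_Icc_real)
    fix t :: real assume "0 \<le> t"
    then show "((\<lambda>t. (1 + t) powr (1 + \<beta>) / (1 + \<beta>)) has_real_derivative (1 + t) powr \<beta>) (at t)"
      using DERIV_cdivide[OF DERIV_chain2[of "\<lambda>z. z powr (1 + \<beta>)" "(1 + \<beta>) * (1 + t) powr (1 + \<beta> - 1)" "\<lambda>t. 1 + t" t 1]]
        has_real_derivative_powr[of "1 + t" "1 + \<beta>"] assms
      by (auto intro!: derivative_eq_intros)
    show "isCont (\<lambda>t. (1 + t) powr \<beta>) t"
      using \<open>0 \<le> t\<close> by (intro continuous_intros) auto
  qed (use assms in auto)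
  then show "integrable lborel (\<lambda>t. indicator {0..R} t * (1 + t) powr \<beta>)"
    and "(LINT t|lborel. indicator {0..R} t * (1 + t) powr \<beta>) = ((1 + R) powr (1 + \<beta>) - 1) / (1 + \<beta>)"
    by (simp_all add: has_bochner_integral_iff mult.commute diff_divide_distrib)
qed

context blowup_test_function
begin

text \<open>At negative times \<open>time_cut\<close> is identically 1; the support condition is
  checked on the strip alone.\<close>

lemma strip_test_fun_test:
  assumes R: "R > 0" "ennreal R < T" and L: "L > 0"
  shows "strip_test_fun T (test R L :: real \<times> (real^'n) \<Rightarrow> real)"
  unfolding strip_test_fun_def
proof (intro conjI exI[of _ "{0..R} \<times> cball 0 L"])
  show "smooth (test R L :: real \<times> (real^'n) \<Rightarrow> real)"
    unfolding test_def by (intro smooth_product smooth_mult g smooth_time_cut smooth_space_cut)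
  show "compact ({0..R} \<times> cball (0::real^'n) L)"
    by (intro compact_Times) auto
  have "ennreal t < T" if "t \<le> R" for t
    using that R by (meson ennreal_leI le_less_trans)
  then show "{0..R} \<times> cball (0::real^'n) L \<subseteq> strip T"
    by (auto simp: strip_def time_interval_def)
  show "\<forall>z\<in>strip T - {0..R} \<times> cball (0::real^'n) L. test R L z = 0"
  proof
    fix z :: "real \<times> (real^'n)" assume "z \<in> strip T - {0..R} \<times> cball 0 L"
    then have "fst z > R \<or> snd z \<notin> cball 0 L"
      by (cases z) (auto simp: strip_def time_interval_def)
    from cuts_vanish[OF R(1) L this] show "test R L z = 0"
      by (simp add: test_def)
  qed
qed

text \<open>The time cutoff is constant near 0 and \<open>g' 0 = g 0 - 1\<close>, so the coefficient
  of \<open>u0\<close> is \<open>g 0 * j - (g 0 - 1)\<close>. This equals \<open>j\<close> because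
  \<open>j = 1\<close> or \<open>g 0 = 1\<close>, and \<open>g 0 * B_const \<beta> = 1\<close> then
  makes \<open>g 0\<close> a common factor.\<close>

lemma data_term:
  fixes x :: "real^'n"
  assumes R: "R > 0"
  shows "(damping \<alpha> \<beta> (0, x) * u0 x + u1 x) * test R L (0, x) - u0 x * dt (test R L) (0, x) =
    g 0 * ((japanese x powr (- \<alpha>) * B_const \<beta> * u0 x + u1 x) * space_cut L x)"
proof -
  have a: "smooth (\<lambda>t. g t * time_cut R t)"
    by (intro smooth_mult g smooth_time_cut)
  have tc: "time_cut R 0 = 1" "dir_deriv 1 (time_cut R) 0 = 0"
    using H_1 H'_0 by (simp_all add: time_cut_def dir_deriv_time_cut(1))
  have dg: "dir_deriv 1 g 0 = g 0 - 1"
    using dir_deriv_eq_DERIV[OF ode[of 0]] w_eq[of 0] by simp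
  have "dir_deriv 1 (\<lambda>t. g t * time_cut R t) 0
      = dir_deriv 1 g 0 * time_cut R 0 + g 0 * dir_deriv 1 (time_cut R) 0"
    by (intro dir_deriv_mult smooth_imp_differentiable g smooth_time_cut)
  then have dt: "dt (test R L) (0, x) = (g 0 - 1) * space_cut L x"
    using dt_product[OF a smooth_space_cut[of L, where 'a="real^'n"]]
    by (simp add: test_def tc dg)
  have g0': "g 0 \<noteq> 0" using g_pos[of 0] by simp
  then have B: "g 0 * B_const \<beta> = 1" by (simp add: g0)
  define j where "j = japanese x powr (- \<alpha>)"
  have "\<beta> = 0 \<or> j = 1"
    using \<alpha>\<beta> japanese_powr[of x 0] by (auto simp: j_def) (simp add: add_pos_nonneg less_imp_neq[symmetric])
  then have key: "g 0 * j - (g 0 - 1) = j"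
    using g_1[of 0] by auto
  have "(j * u0 x + u1 x) * (g 0 * space_cut L x) - u0 x * ((g 0 - 1) * space_cut L x)
      = ((g 0 * j - (g 0 - 1)) * u0 x + g 0 * u1 x) * space_cut L x"
    by (simp add: algebra_simps)
  also have "\<dots> = (g 0 * B_const \<beta> * j * u0 x + g 0 * u1 x) * space_cut L x"
    by (simp only: key B) simp
  also have "\<dots> = g 0 * ((j * B_const \<beta> * u0 x + u1 x) * space_cut L x)"
    by (simp add: algebra_simps)
  finally show ?thesis
    unfolding dt by (simp add: test_def tc damping_def j_def)
qed

text \<open>Integrating the first summand over times of length \<open>R / 2\<close> adds 1 to its
  exponent, and \<open>1 - q = - 1 / (p - 1)\<close>. The 4 estimates
  \<open>2 powr (1 + \<beta>)\<close>.\<close>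

lemma majorant_integral:
  assumes R: "R \<ge> 1" and L: "L > 0"
  shows "integrable lebesgue (majorant R L :: real \<times> (real^'n) \<Rightarrow> real)"
    and "(LINT z|lebesgue. majorant R L (z :: real \<times> (real^'n))) \<le>
      R powr (- (1 + \<beta>) / (p - 1)) *
        (LINT x|lborel. indicator (cball (0::real^'n) L) x * japanese x powr (- (\<alpha> * q)))
      + 4 / (1 + \<beta>) * R powr (1 + \<beta>) * L powr (real CARD('n) - 2 * q) * measure lborel (cball (0::real^'n) 1)"
proof -
  define a1 where "a1 t = indicator {R/2..R} t * R powr (- \<beta> / (p - 1) - q)" for t :: real
  define a2 where "a2 t = indicator {0..R} t * (1 + t) powr \<beta>" for t :: real
  define b1 where "b1 x = indicator (cball 0 L) x * japanese x powr (- (\<alpha> * q))" for x :: "real^'n"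
  define b2 where "b2 x = L powr (- (2 * q)) * indicator (cball 0 L) x" for x :: "real^'n"
  have maj: "majorant R L = (\<lambda>z. a1 (fst z) * b1 (snd z) + a2 (fst z) * b2 (snd z))"
    by (simp add: majorant_def a1_def a2_def b1_def b2_def)
  have ind: "integrable lborel (indicator (cball (0::real^'n) L) :: _ \<Rightarrow> real)"
    by (rule integrable_real_indicator) (auto simp: emeasure_lborel_cball_finite[unfolded infinity_ennreal_def])
  have ind': "integrable lborel (indicator {R/2..R} :: _ \<Rightarrow> real)"
    by (rule integrable_real_indicator) (auto simp: emeasure_lborel_Icc_eq)
  have ia1: "integrable lborel a1" unfolding a1_def using ind' by simp
  have ia2: "integrable lborel a2"
    unfolding a2_def using shifted_powr_integral(1)[OF \<beta>(1)] R by simp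
  have ib1: "integrable lborel b1"
    unfolding b1_def by (rule integrable_japanese_powr_cball)
  have ib2: "integrable lborel b2" unfolding b2_def using ind by simp
  have int: "integrable lborel (majorant R L :: real \<times> (real^'n) \<Rightarrow> real)"
    unfolding maj
    by (intro Bochner_Integration.integrable_add lborel_product_integrable ia1 ia2 ib1 ib2)
  then show "integrable lebesgue (majorant R L :: real \<times> (real^'n) \<Rightarrow> real)"
    by (simp add: integrable_completion)
  have q1: "1 - q = - 1 / (p - 1)" using p by (simp add: q field_simps)
  have "integral\<^sup>L lborel a1 = R / 2 * R powr (- \<beta> / (p - 1) - q)"
    unfolding a1_def using R by simp
  also have "\<dots> \<le> R * R powr (- \<beta> / (p - 1) - q)"
    using R by (intro mult_right_mono) auto
  also have "\<dots> = R powr (1 + (- \<beta> / (p - 1) - q))"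
    using R by (simp only: powr_add) simp
  also have "1 + (- \<beta> / (p - 1) - q) = - (1 + \<beta>) / (p - 1)"
    using q1 by (simp add: diff_divide_distrib add_divide_distrib)
  finally have A1: "integral\<^sup>L lborel a1 \<le> R powr (- (1 + \<beta>) / (p - 1))" .
  have "integral\<^sup>L lborel a2 = ((1 + R) powr (1 + \<beta>) - 1) / (1 + \<beta>)"
    unfolding a2_def using shifted_powr_integral(2)[OF \<beta>(1)] R by simp
  also have "\<dots> \<le> (2 * R) powr (1 + \<beta>) / (1 + \<beta>)"
    using \<beta> R powr_mono2[of "1 + \<beta>" "1 + R" "2 * R"] by (intro divide_right_mono) auto
  also have "(2 * R) powr (1 + \<beta>) = 2 powr (1 + \<beta>) * R powr (1 + \<beta>)"
    using R by (simp add: powr_mult)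
  also have "2 powr (1 + \<beta>) * R powr (1 + \<beta>) / (1 + \<beta>) \<le> 4 * R powr (1 + \<beta>) / (1 + \<beta>)"
    using \<beta> powr_mono[of "1 + \<beta>" 2 "2::real"] by (intro divide_right_mono mult_right_mono) auto
  finally have A2: "integral\<^sup>L lborel a2 \<le> 4 / (1 + \<beta>) * R powr (1 + \<beta>)" by simp
  have "integral\<^sup>L lborel b2 = L powr (- (2 * q)) * (L ^ CARD('n) * measure lborel (cball (0::real^'n) 1))"
    unfolding b2_def using measure_cball_scale[OF L, where 'n='n] by simp
  also have "\<dots> = L powr (real CARD('n) - 2 * q) * measure lborel (cball (0::real^'n) 1)"
    using L powr_add[of L "- (2 * q)" "real CARD('n)"] by (simp add: powr_realpow)
  finally have B2: "integral\<^sup>L lborel b2 = L powr (real CARD('n) - 2 * q) * measure lborel (cball (0::real^'n) 1)" .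
  have "(LINT z|lebesgue. majorant R L (z :: real \<times> (real^'n))) = (LINT z|lborel. majorant R L (z :: real \<times> (real^'n)))"
    using int by (intro integral_completion) auto
  also have "\<dots> = integral\<^sup>L lborel a1 * integral\<^sup>L lborel b1 + integral\<^sup>L lborel a2 * integral\<^sup>L lborel b2"
    unfolding maj
    by (subst Bochner_Integration.integral_add)
      (simp_all add: lborel_product_integral ia1 ia2 ib1 ib2)
  also have "\<dots> \<le> R powr (- (1 + \<beta>) / (p - 1)) * integral\<^sup>L lborel b1
      + 4 / (1 + \<beta>) * R powr (1 + \<beta>) * integral\<^sup>L lborel b2"
    by (intro add_mono mult_right_mono A1 A2 integral_nonneg) (auto simp: b1_def b2_def)
  finally show "(LINT z|lebesgue. majorant R L (z :: real \<times> (real^'n))) \<le>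
      R powr (- (1 + \<beta>) / (p - 1)) *
        (LINT x|lborel. indicator (cball (0::real^'n) L) x * japanese x powr (- (\<alpha> * q)))
      + 4 / (1 + \<beta>) * R powr (1 + \<beta>) * L powr (real CARD('n) - 2 * q) * measure lborel (cball (0::real^'n) 1)"
    unfolding B2 unfolding b1_def by (simp add: mult_ac)
qed

text \<open>After integration of \<open>adjoint_op_Young\<close> the nonlinear integral stands on
  both sides and cancels, which is legitimate because \<open>is_solution\<close> includes the
  integrability of both integrands.\<close>

lemma solution_inequality:
  fixes u :: "real \<Rightarrow> real^'n \<Rightarrow> real"
  assumes sol: "is_solution \<alpha> \<beta> p \<epsilon> u0 u1 T u"
    and R: "R \<ge> 1" "ennreal R < T" and L: "L > 0" "L \<le> R"
  shows "\<epsilon> * (g 0 * (LINT x|lebesgue. (japanese x powr (- \<alpha>) * B_const \<beta> * u0 x + u1 x) * space_cut L x))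
    \<le> Young_const CARD('n) * (LINT z|lebesgue. majorant R L (z :: real \<times> (real^'n)))"
proof -
  define lin where "lin = (\<lambda>z. u (fst z) (snd z) * adjoint_op R L z)"
  define nonlin where "nonlin = (\<lambda>z. \<bar>u (fst z) (snd z)\<bar> powr p * test R L z)"
  have "strip_test_fun T (test R L :: real \<times> (real^'n) \<Rightarrow> real)"
    using R L by (intro strip_test_fun_test) auto
  with sol have int: "set_integrable lebesgue (strip T) lin" "set_integrable lebesgue (strip T) nonlin"
    and id: "(LINT z:strip T|lebesgue. lin z) =
      \<epsilon> * (LINT x|lebesgue. (damping \<alpha> \<beta> (0, x) * u0 x + u1 x) * test R L (0, x)
                     - u0 x * dt (test R L) (0, x))
      + (LINT z:strip T|lebesgue. nonlin z)"
    unfolding is_solution_def Let_def lin_def nonlin_def adjoint_op_def by (auto simp: case_prod_beta')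
  have pt: "indicator (strip T) z *\<^sub>R lin z \<le> indicator (strip T) z *\<^sub>R nonlin z + Young_const CARD('n) * majorant R L z"
    for z :: "real \<times> (real^'n)"
  proof (cases "z \<in> strip T")
    case True
    then have "fst z \<ge> 0" by (auto simp: strip_def time_interval_def)
    from adjoint_op_Young[OF R(1) L this, of "u (fst z) (snd z)" "snd z"] True
    show ?thesis by (simp add: lin_def nonlin_def)
  next
    case False
    then show ?thesis by (simp add: Young_const_nonneg majorant_nonneg)
  qed
  note maj = majorant_integral(1)[OF R(1) L(1), where 'n='n]
  have "(LINT z:strip T|lebesgue. lin z)
      \<le> (LINT z|lebesgue. indicator (strip T) z *\<^sub>R nonlin z + Young_const CARD('n) * majorant R L z)"
    unfolding set_lebesgue_integral_def
    using int maj unfolding set_integrable_def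
    by (intro integral_mono pt Bochner_Integration.integrable_add integrable_mult_right) auto
  also have "\<dots> = (LINT z:strip T|lebesgue. nonlin z)
      + Young_const CARD('n) * (LINT z|lebesgue. majorant R L (z :: real \<times> (real^'n)))"
    using int maj unfolding set_integrable_def set_lebesgue_integral_def
    by (subst Bochner_Integration.integral_add) auto
  finally have "\<epsilon> * (LINT x|lebesgue. (damping \<alpha> \<beta> (0, x) * u0 x + u1 x) * test R L (0, x)
                     - u0 x * dt (test R L) (0, x))
    \<le> Young_const CARD('n) * (LINT z|lebesgue. majorant R L (z :: real \<times> (real^'n)))"
    unfolding id by simp
  moreover have "R > 0" using R by simp
  ultimately show ?thesis by (simp add: data_term)
qed

text \<open>Applied to the combination of the data as a whole, since the integrability assumption
  concerns that combination and not its two summands.\<close>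

lemma space_cut_integral_tendsto:
  fixes f :: "real^'n \<Rightarrow> real"
  assumes f: "integrable lebesgue f"
  shows "((\<lambda>L. LINT x|lebesgue. f x * space_cut L x) \<longlongrightarrow> (LINT x|lebesgue. f x)) at_top"
proof (rule integral_dominated_convergence_at_top)
  show "f \<in> borel_measurable lebesgue" "integrable lebesgue (\<lambda>x. \<bar>f x\<bar>)" using f by auto
  have "space_cut L \<in> borel_measurable borel" for L
    using smooth_imp_continuous_on[OF smooth_space_cut] by (rule borel_measurable_continuous_onI)
  then have "space_cut L \<in> borel_measurable lebesgue" for L :: real
    by (metis measurable_completion measurable_lborel2)
  with f show "(\<lambda>x. f x * space_cut L x) \<in> borel_measurable lebesgue" for L
    by (intro borel_measurable_times) auto
  show "AE x in lebesgue. ((\<lambda>L. f x * space_cut L x) \<longlongrightarrow> f x) at_top"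
  proof (rule AE_I2)
    fix x :: "real^'n"
    have "space_cut L x = 1" if "L \<ge> 1 + 2 * norm x" for L
      unfolding space_cut_def
    proof (rule H_1)
      have "(2 * norm x)\<^sup>2 \<le> L\<^sup>2" using that by (intro power_mono) auto
      then have "4 * (norm x)\<^sup>2 \<le> L\<^sup>2" by (simp add: power_mult_distrib)
      then have "2 * (norm x)\<^sup>2 \<le> L\<^sup>2"
        using zero_le_power2[of "norm x"] by linarith
      moreover have "L > 0" using that norm_ge_zero[of x] by linarith
      ultimately show "1 / L\<^sup>2 * (x \<bullet> x) \<le> 1 / 2"
        by (simp add: power2_norm_eq_inner[symmetric] power_mult_distrib divide_simps)
    qed
    then show "((\<lambda>L. f x * space_cut L x) \<longlongrightarrow> f x) at_top"
      by (intro tendsto_eventually eventually_at_top_linorderI[of "1 + 2 * norm x"]) simp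
  qed
  show "\<forall>\<^sub>F L in at_top. AE x in lebesgue. norm (f x * space_cut L x) \<le> \<bar>f x\<bar>"
  proof (intro always_eventually allI AE_I2)
    fix L and x :: "real^'n"
    show "norm (f x * space_cut L x) \<le> \<bar>f x\<bar>"
      using cut_bounds(3)[of L x] cut_bounds(4)[of L x] by (simp add: abs_mult mult_left_le)
  qed
qed

end

section \<open>Lifespan\<close>

text \<open>\<open>T\<close> may be infinite, whereas the test function is cut off at a finite time
  before \<open>T\<close>; density supplies a real \<open>R\<close> between \<open>b\<close> and
  \<open>T\<close>.\<close>

lemma lifespan_le:
  fixes u0 u1 :: "real^'n \<Rightarrow> real"
  assumes "\<And>T u R. is_solution \<alpha> \<beta> p \<epsilon> u0 u1 T u \<Longrightarrow> b < R \<Longrightarrow> ennreal R < T \<Longrightarrow> False"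
    and "0 \<le> b"
  shows "lifespan \<alpha> \<beta> p u0 u1 \<epsilon> \<le> ennreal b"
  unfolding lifespan_def
proof (rule Sup_least)
  fix T assume "T \<in> {T. 0 < T \<and> (\<exists>u. is_solution \<alpha> \<beta> p \<epsilon> u0 u1 T u \<and>
        (\<forall>v. is_solution \<alpha> \<beta> p \<epsilon> u0 u1 T v \<longrightarrow>
           (\<forall>t\<in>time_interval T. AE x in lebesgue. v t x = u t x)))}"
  then obtain u where sol: "is_solution \<alpha> \<beta> p \<epsilon> u0 u1 T u" by blast
  show "T \<le> ennreal b"
  proof (rule ccontr)
    assume "\<not> T \<le> ennreal b"
    then obtain r where r: "ennreal b < r" "r < T" by (meson dense not_le)
    then have fin: "r = ennreal (enn2real r)" by (metis ennreal_enn2real less_le_trans top_greatest)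
    with r(1) \<open>0 \<le> b\<close> have "b < enn2real r" by (metis ennreal_less_iff)
    with assms(1)[OF sol] fin r(2) show False by metis
  qed
qed

section \<open>From decay in time to bounds for the time\<close>

lemma powr_decay_imp_bound:
  fixes \<epsilon> d K R \<kappa> :: real
  assumes "\<epsilon> * d \<le> K * R powr (- \<kappa>)" "0 < \<kappa>" "0 < \<epsilon>" "0 < d" "0 < K" "0 < R"
  shows "R \<le> (K / d) powr (1 / \<kappa>) * \<epsilon> powr (- 1 / \<kappa>)"
proof -
  have "R powr \<kappa> \<le> K / d * \<epsilon> powr (- 1)"
    using assms by (simp add: powr_minus field_simps)
  then have "(R powr \<kappa>) powr (1 / \<kappa>) \<le> (K / d * \<epsilon> powr (- 1)) powr (1 / \<kappa>)"
    using assms by (intro powr_mono2) auto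
  also have "\<dots> = (K / d) powr (1 / \<kappa>) * (\<epsilon> powr (- 1)) powr (1 / \<kappa>)"
    using assms by (subst powr_mult) auto
  also have "(\<epsilon> powr (- 1)) powr (1 / \<kappa>) = \<epsilon> powr (- 1 / \<kappa>)"
    unfolding powr_powr by simp
  also have "(R powr \<kappa>) powr (1 / \<kappa>) = R"
    using assms by (simp add: powr_powr)
  finally show ?thesis .
qed

text \<open>Two rounds: the logarithm is first estimated by a square root, which gives the crude
  quadratic bound; the logarithm of the crude bound, of order
  \<open>ln (inverse \<epsilon>)\<close>, is then inserted into the hypothesis.\<close>

lemma log_decay_imp_bound:
  fixes \<epsilon> N S :: real
  assumes le: "\<epsilon> * S \<le> N * (1 + ln S)" and pos: "0 < \<epsilon>" "0 < N" "1 \<le> S"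
  shows "S \<le> (2 * N / \<epsilon>)\<^sup>2"
    and "S \<le> N * (1 + 2 * \<bar>ln (2 * N)\<bar> + 2 * ln (inverse \<epsilon>)) / \<epsilon>"
proof -
  have sq: "sqrt S \<ge> 1" "sqrt S * sqrt S = S" using pos by simp_all
  have "ln S = 2 * ln (sqrt S)" using pos by (simp add: ln_sqrt)
  also have "\<dots> \<le> 2 * (sqrt S - 1)"
    using ln_le_minus_one[of "sqrt S"] sq by simp
  finally have "N * (1 + ln S) \<le> N * (2 * sqrt S)" using pos by simp
  with le sq have "(\<epsilon> * sqrt S) * sqrt S \<le> (2 * N) * sqrt S" by (simp add: mult_ac)
  then have "\<epsilon> * sqrt S \<le> 2 * N" using sq by (simp add: mult_le_cancel_right)
  then have "sqrt S \<le> 2 * N / \<epsilon>" using pos by (simp add: field_simps)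
  then have "(sqrt S)\<^sup>2 \<le> (2 * N / \<epsilon>)\<^sup>2" using pos by (intro power_mono) auto
  then show S: "S \<le> (2 * N / \<epsilon>)\<^sup>2" using pos by simp
  have "ln S \<le> ln ((2 * N / \<epsilon>)\<^sup>2)" using S pos by simp
  also have "\<dots> = 2 * (ln (2 * N) + ln (inverse \<epsilon>))"
    using pos by (simp add: ln_realpow ln_div ln_inverse)
  also have "\<dots> \<le> 2 * \<bar>ln (2 * N)\<bar> + 2 * ln (inverse \<epsilon>)" by simp
  finally have "N * (1 + ln S) \<le> N * (1 + 2 * \<bar>ln (2 * N)\<bar> + 2 * ln (inverse \<epsilon>))" using pos by simp
  with le pos show "S \<le> N * (1 + 2 * \<bar>ln (2 * N)\<bar> + 2 * ln (inverse \<epsilon>)) / \<epsilon>"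
    by (simp add: field_simps)
qed

text \<open>The first factor is the exponent \<open>s\<close> of the scaling
  \<open>L = R powr s\<close>.\<close>

lemma kappa_eq: "kappa n \<alpha> \<beta> p = (1 + \<beta>) / (2 - \<alpha>) * (2 / (p - 1) - (real n - \<alpha>))"
proof -
  have "2 * a / b * (y - x / 2) = a / b * (2 * y - x)" for a b x y :: real
    by (simp add: right_diff_distrib)
  from this[of "1 + \<beta>" "2 - \<alpha>" "1 / (p - 1)" "real n - \<alpha>"] show ?thesis
    by (simp add: kappa_def)
qed

text \<open>\<open>K\<close>, \<open>d\<close> and \<open>R0\<close> are obtained before \<epsilon>,
  \<open>T\<close> and \<open>u\<close> are fixed; this uniformity lets the final constants depend
  on the data alone.\<close>

lemma (in blowup_test_function) time_inequality:
  fixes u0 u1 :: "real^'n \<Rightarrow> real"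
  assumes \<alpha>1: "\<alpha> < 1"
    and f: "integrable lebesgue (\<lambda>x. japanese x powr (- \<alpha>) * B_const \<beta> * u0 x + u1 x)"
    and f_pos: "(LINT x|lebesgue. japanese x powr (- \<alpha>) * B_const \<beta> * u0 x + u1 x) > 0"
  obtains K d R0 where "K > 0" "d > 0" "R0 \<ge> 1"
    "\<And>\<epsilon> T u R. is_solution \<alpha> \<beta> p \<epsilon> u0 u1 T u \<Longrightarrow> 0 < \<epsilon> \<Longrightarrow> R0 \<le> R \<Longrightarrow> ennreal R < T \<Longrightarrow>
      \<epsilon> * d \<le> K * (R powr (- (1 + \<beta>) / (p - 1)) *
          (LINT x|lborel. indicator (cball (0::real^'n) (R powr ((1 + \<beta>) / (2 - \<alpha>)))) x * japanese x powr (- (\<alpha> * q)))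
        + R powr (- kappa CARD('n) \<alpha> \<beta> p))"
proof -
  define F where "F x = japanese x powr (- \<alpha>) * B_const \<beta> * u0 x + u1 x" for x :: "real^'n"
  define I where "I = (LINT x|lebesgue. F x)"
  have I: "I > 0" using f_pos by (simp add: I_def F_def)
  have Fint: "integrable lebesgue F" using f by (simp add: F_def[abs_def])
  have "\<forall>\<^sub>F L in at_top. I / 2 < (LINT x|lebesgue. F x * space_cut L x)"
    using order_tendstoD(1)[OF space_cut_integral_tendsto[OF Fint], of "I / 2"] I
    by (simp add: I_def)
  then obtain L0 where L0: "\<And>L. L \<ge> L0 \<Longrightarrow> I / 2 < (LINT x|lebesgue. F x * space_cut L x)"
    by (auto simp: eventually_at_top_linorder)
  define s where "s = (1 + \<beta>) / (2 - \<alpha>)"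
  have s: "0 < s" using \<alpha>1 \<beta> by (simp add: s_def)
  \<comment> \<open>As \<alpha> or \<beta> is 0, \<open>s\<close> is
    \<open>(1 + \<beta>) / 2\<close> or \<open>1 / (2 - \<alpha>)\<close>. The bound gives
    \<open>L \<le> R\<close>, needed to discard the second time derivative against the
    Laplacian.\<close>
  have s1: "s \<le> 1" using \<alpha>1 \<beta> \<alpha>\<beta> by (auto simp: s_def field_simps)
  \<comment> \<open>From this time on, \<open>L = R powr s\<close> is at least \<open>L0\<close>, so
    the cut-off data integral exceeds half of the full one.\<close>
  define R0 where "R0 = max 1 (max 1 L0 powr (1 / s))"
  define V where "V = measure lborel (cball (0::real^'n) 1)"
  define Y where "Y = Young_const CARD('n)"
  \<comment> \<open>The added 1 only makes \<open>K\<close> positive.\<close>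
  define K where "K = Y * (1 + 4 / (1 + \<beta>) * V) + 1"
  have V: "V \<ge> 0" by (simp add: V_def)
  have Y: "Y \<ge> 0" by (simp add: Y_def Young_const_nonneg)
  have cV: "4 / (1 + \<beta>) * V \<ge> 0" using V \<beta> by simp
  have g0: "g 0 > 0" by (rule g_pos) simp
  show thesis
  proof (rule that[of K "g 0 * (I / 2)" R0])
    show "K > 0" unfolding K_def using Y cV by (intro add_nonneg_pos mult_nonneg_nonneg) auto
    show "g 0 * (I / 2) > 0" using g0 I by simp
    show "R0 \<ge> 1" by (simp add: R0_def)
    fix \<epsilon> T u R
    assume sol: "is_solution \<alpha> \<beta> p \<epsilon> u0 u1 T u" and \<epsilon>: "0 < \<epsilon>" and R: "R0 \<le> R" "ennreal R < T"
    define L where "L = R powr s"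
    have R1: "R \<ge> 1" using R by (simp add: R0_def)
    then have L: "L > 0" "L \<le> R"
      using powr_mono[OF s1, of R] by (auto simp: L_def)
    have "max 1 L0 = (max 1 L0 powr (1 / s)) powr s" using s by (simp add: powr_powr)
    also have "\<dots> \<le> L" unfolding L_def using R s by (intro powr_mono2) (auto simp: R0_def)
    finally have LL0: "L \<ge> L0" by simp
    define J where "J = (LINT x|lborel. indicator (cball (0::real^'n) L) x * japanese x powr (- (\<alpha> * q)))"
    have J: "J \<ge> 0" unfolding J_def by (intro Bochner_Integration.integral_nonneg) simp
    \<comment> \<open>Since \<open>1 + \<beta> = s * (2 - \<alpha>)\<close>, all terms share the
      factor \<open>s\<close>; with \<open>2 * q = 2 + 2 / (p - 1)\<close> the second factor is
      minus that in \<open>kappa_eq\<close>.\<close>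
    have exponent: "(1 + \<beta>) + s * (real CARD('n) - 2 * q) = - kappa CARD('n) \<alpha> \<beta> p"
    proof -
      have q2: "2 * q = 2 + 2 / (p - 1)" using p by (simp add: q field_simps)
      have "1 + \<beta> = s * (2 - \<alpha>)" using \<alpha>1 by (simp add: s_def)
      then have "(1 + \<beta>) + s * (real CARD('n) - 2 * q) = s * ((2 - \<alpha>) + (real CARD('n) - 2 * q))"
        by (simp only: distrib_left)
      also have "(2 - \<alpha>) + (real CARD('n) - 2 * q) = - (2 / (p - 1) - (real CARD('n) - \<alpha>))"
        unfolding q2 by simp
      finally show ?thesis unfolding kappa_eq s_def[symmetric] by (simp only: mult_minus_right)
    qed
    have RL: "R powr (1 + \<beta>) * L powr (real CARD('n) - 2 * q) = R powr (- kappa CARD('n) \<alpha> \<beta> p)"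
      unfolding L_def powr_powr powr_add[symmetric] exponent ..
    have "\<epsilon> * (g 0 * (I / 2)) \<le> \<epsilon> * (g 0 * (LINT x|lebesgue. F x * space_cut L x))"
      using \<epsilon> g0 L0[OF LL0] by (intro mult_left_mono) auto
    also have "\<dots> \<le> Y * (LINT z|lebesgue. majorant R L (z :: real \<times> (real^'n)))"
      using solution_inequality[OF sol R1 R(2) L] by (simp add: Y_def F_def)
    also have "\<dots> \<le> Y * (R powr (- (1 + \<beta>) / (p - 1)) * J
        + 4 / (1 + \<beta>) * R powr (1 + \<beta>) * L powr (real CARD('n) - 2 * q) * V)"
      unfolding J_def V_def using Y by (intro mult_left_mono majorant_integral(2) R1 L)
    also have "4 / (1 + \<beta>) * R powr (1 + \<beta>) * L powr (real CARD('n) - 2 * q) * V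
        = 4 / (1 + \<beta>) * V * R powr (- kappa CARD('n) \<alpha> \<beta> p)"
      unfolding RL[symmetric] by simp
    also have "Y * (R powr (- (1 + \<beta>) / (p - 1)) * J + 4 / (1 + \<beta>) * V * R powr (- kappa CARD('n) \<alpha> \<beta> p))
        \<le> Y * ((1 + 4 / (1 + \<beta>) * V) * (R powr (- (1 + \<beta>) / (p - 1)) * J)
          + (1 + 4 / (1 + \<beta>) * V) * R powr (- kappa CARD('n) \<alpha> \<beta> p))"
      using mult_right_mono[of 1 "1 + 4 / (1 + \<beta>) * V" "R powr (- (1 + \<beta>) / (p - 1)) * J"] J cV
      by (intro mult_left_mono[OF _ Y] add_mono mult_right_mono) auto
    also have "\<dots> = Y * (1 + 4 / (1 + \<beta>) * V) * (R powr (- (1 + \<beta>) / (p - 1)) * J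
          + R powr (- kappa CARD('n) \<alpha> \<beta> p))"
      by (metis distrib_left mult.assoc)
    also have "\<dots> \<le> K * (R powr (- (1 + \<beta>) / (p - 1)) * J + R powr (- kappa CARD('n) \<alpha> \<beta> p))"
      using J by (intro mult_right_mono) (auto simp: K_def)
    finally show "\<epsilon> * (g 0 * (I / 2)) \<le> K * (R powr (- (1 + \<beta>) / (p - 1)) *
          (LINT x|lborel. indicator (cball (0::real^'n) (R powr ((1 + \<beta>) / (2 - \<alpha>)))) x * japanese x powr (- (\<alpha> * q)))
        + R powr (- kappa CARD('n) \<alpha> \<beta> p))"
      unfolding J_def L_def s_def .
  qed
qed

lemma blowup_test_function_exists:
  fixes \<alpha> \<beta> p :: real
  assumes "0 \<le> \<alpha>" "-1 < \<beta>" "\<beta> < 1" "\<alpha> * \<beta> = 0" "1 < p"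
  obtains c C D g w H where "blowup_test_function \<alpha> \<beta> p (p / (p - 1)) c C D g w H"
proof -
  from weight_exists[OF assms(2,3)] obtain g w c C where gw: "smooth g" "smooth w" "c > 0" "C > 0"
    "\<And>t. t > -1/2 \<Longrightarrow> w t = (1 + t) powr (- \<beta>)"
    "\<And>t. (g has_real_derivative w t * g t - 1) (at t)"
    "g 0 = inverse (B_const \<beta>)"
    "\<And>t. t \<ge> 0 \<Longrightarrow> c * (1 + t) powr \<beta> \<le> g t" "\<And>t. t \<ge> 0 \<Longrightarrow> g t \<le> C * (1 + t) powr \<beta>"
    "\<And>t. \<beta> = 0 \<Longrightarrow> t \<ge> 0 \<Longrightarrow> g t = 1"
    by blast
  from cutoff_exists[OF assms(5)] obtain H :: "real \<Rightarrow> real" and D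
    where H: "smooth H" "\<And>s. 0 \<le> H s" "\<And>s. H s \<le> 1" "D > 0"
    "\<And>s. s \<le> 1/2 \<Longrightarrow> H s = 1" "\<And>s. s \<ge> 1 \<Longrightarrow> H s = 0"
    "\<And>s. s < 1/2 \<Longrightarrow> dir_deriv 1 H s = 0"
    "\<And>s. \<bar>dir_deriv 1 H s\<bar> \<le> D * H s powr (1 / p)"
    "\<And>s. \<bar>dir_deriv 1 (dir_deriv 1 H) s\<bar> \<le> D * H s powr (1 / p)"
    by blast
  have "blowup_test_function \<alpha> \<beta> p (p / (p - 1)) c C D g w H"
    by (rule blowup_test_function.intro) (fact assms gw H refl)+
  then show thesis by (rule that)
qed

text \<open>At \<epsilon> = 1 the logarithm vanishes, and a bound by its power would say that no
  positive \<open>T\<close> qualifies for the lifespan. The critical case is therefore stated on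
  \<open>{0<..\<epsilon>0}\<close> for every \<open>\<epsilon>0 < 1\<close>, with a constant bound
  on the remaining interval.\<close>

theorem theorem2p3:
  fixes \<alpha> \<beta> p :: real
    and u0 u1 :: "(real^'n) \<Rightarrow> real"
  assumes "0 \<le> \<alpha>" and "\<alpha> < 1"
    and "-1 < \<beta>" and "\<beta> < 1"
    and "\<alpha> * \<beta> = 0"
    and "1 < p" and "p < 1 + 2 / (real CARD('n) - \<alpha>)"
    and "u0 \<in> H1" and "u1 \<in> L2"
    and "integrable lebesgue (\<lambda>x. japanese x powr (- \<alpha>) * B_const \<beta> * u0 x + u1 x)"
    and "(LINT x|lebesgue. japanese x powr (- \<alpha>) * B_const \<beta> * u0 x + u1 x) > 0"
  shows
    "(1 + \<alpha> / (real CARD('n) - \<alpha>) < p \<longrightarrow>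
        (\<exists>C>0. \<forall>\<epsilon>\<in>{0<..1}.
           lifespan \<alpha> \<beta> p u0 u1 \<epsilon> \<le> ennreal (C * \<epsilon> powr (- 1 / kappa CARD('n) \<alpha> \<beta> p))))
     \<and> (\<alpha> > 0 \<and> p = 1 + \<alpha> / (real CARD('n) - \<alpha>) \<longrightarrow>
        (\<forall>\<epsilon>0\<in>{0<..<1}. \<exists>C>0.
           (\<forall>\<epsilon>\<in>{0<..\<epsilon>0}.
              lifespan \<alpha> \<beta> p u0 u1 \<epsilon>
                \<le> ennreal (C * (\<epsilon> powr (- (p - 1)) * (ln (inverse \<epsilon>)) powr (p - 1))))
           \<and> (\<forall>\<epsilon>\<in>{\<epsilon>0<..1}. lifespan \<alpha> \<beta> p u0 u1 \<epsilon> \<le> ennreal C)))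
     \<and> (\<alpha> > 0 \<and> p < 1 + \<alpha> / (real CARD('n) - \<alpha>) \<longrightarrow>
        (\<exists>C>0. \<forall>\<epsilon>\<in>{0<..1}.
           lifespan \<alpha> \<beta> p u0 u1 \<epsilon> \<le> ennreal (C * \<epsilon> powr (- (p - 1)))))"
proof -
  define n where "n = real CARD('n)"
  define q where "q = p / (p - 1)"
  define \<kappa> where "\<kappa> = kappa CARD('n) \<alpha> \<beta> p"
  define J where "J L = (LINT x|lborel. indicator (cball (0::real^'n) L) x * japanese x powr (- (\<alpha> * q)))" for L
  define s where "s = (1 + \<beta>) / (2 - \<alpha>)"
  have n: "n \<ge> 1" by (simp add: n_def Suc_le_eq)
  then have n\<alpha>: "n - \<alpha> > 0" using assms(2) by simp
  have s: "0 < s" "s \<le> 1" using assms(1-5) by (auto simp: s_def field_simps)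
  have p1: "p - 1 > 0" using assms(6) by simp
  have \<alpha>q: "0 \<le> \<alpha> * q" using assms(1) p1 assms(6) by (simp add: q_def)
  \<comment> \<open>The exponent \<open>\<alpha> * q\<close> of the integrand is critical for
    integrability at infinity when \<open>\<alpha> * p = n * (p - 1)\<close>, that is
    \<open>p = n / (n - \<alpha>)\<close>.\<close>
  have crit: "\<alpha> * q < n \<longleftrightarrow> 1 + \<alpha> / (n - \<alpha>) < p" "\<alpha> * q = n \<longleftrightarrow> p = 1 + \<alpha> / (n - \<alpha>)"
    "n < \<alpha> * q \<longleftrightarrow> p < 1 + \<alpha> / (n - \<alpha>)"
    using p1 n\<alpha> by (auto simp: q_def field_simps)
  have \<kappa>_eq: "\<kappa> = s * (2 / (p - 1) - (n - \<alpha>))"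
    by (simp add: \<kappa>_def kappa_eq s_def n_def)
  have "2 / (p - 1) - (n - \<alpha>) > 0"
    using assms(7) p1 n\<alpha> by (simp add: n_def[symmetric] field_simps)
  then have \<kappa>: "\<kappa> > 0" using s by (simp add: \<kappa>_eq)
  obtain c C D g w H where "blowup_test_function \<alpha> \<beta> p (p / (p - 1)) c C D g w H"
    by (rule blowup_test_function_exists[OF assms(1,3-6)])
  note time_inequality = blowup_test_function.time_inequality[OF this assms(2,10,11)]
  obtain K d R0 where K: "K > 0" and d: "d > 0" and R0: "R0 \<ge> 1"
    and main: "\<And>\<epsilon> T u R. is_solution \<alpha> \<beta> p \<epsilon> u0 u1 T u \<Longrightarrow> 0 < \<epsilon> \<Longrightarrow> R0 \<le> R \<Longrightarrow> ennreal R < T \<Longrightarrow>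
      \<epsilon> * d \<le> K * (R powr (- (1 + \<beta>) / (p - 1)) * J (R powr s) + R powr (- \<kappa>))"
    unfolding J_def q_def s_def \<kappa>_def
    by (rule time_inequality) blast
  obtain M where M: "M > 0"
    and J1: "\<And>L. 1 \<le> L \<Longrightarrow> \<alpha> * q < n \<Longrightarrow> J L \<le> M * L powr (n - \<alpha> * q)"
    and J2: "\<And>L. 1 \<le> L \<Longrightarrow> \<alpha> * q = n \<Longrightarrow> J L \<le> M * (1 + ln L)"
    and J3: "\<And>L. 1 \<le> L \<Longrightarrow> \<alpha> * q > n \<Longrightarrow> J L \<le> M"
    unfolding J_def n_def by (rule japanese_powr_integral_bounds[OF \<alpha>q]) blast
  have Ls: "1 \<le> R powr s" if "R0 \<le> R" for R
    using that R0 s by (intro ge_one_powr_ge_zero) auto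
  define K' where "K' = K * (M + 1)"
  have K': "K' > 0" using K M by (simp add: K'_def)
  \<comment> \<open>Shared by the two regimes with pure powers, with rates \<open>\<kappa>\<close>
    and \<open>1 / (p - 1)\<close>. \<open>R0\<close> enters the constant because
    \<open>main\<close> says nothing about earlier times; as
    \<open>\<epsilon> powr (- 1 / r) \<ge> 1\<close>, the claimed bound is then at least
    \<open>R0\<close>.\<close>
  have decay: "\<exists>C>0. \<forall>\<epsilon>\<in>{0<..1}. lifespan \<alpha> \<beta> p u0 u1 \<epsilon> \<le> ennreal (C * \<epsilon> powr (- 1 / r))"
    if r: "r > 0" and le: "\<And>R. R0 \<le> R \<Longrightarrow>
      R powr (- (1 + \<beta>) / (p - 1)) * J (R powr s) + R powr (- \<kappa>) \<le> (M + 1) * R powr (- r)" for r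
  proof (intro exI conjI ballI)
    let ?C = "max R0 ((K' / d) powr (1 / r))"
    show "?C > 0" using R0 by simp
    fix \<epsilon> :: real assume "\<epsilon> \<in> {0<..1}"
    then have \<epsilon>: "0 < \<epsilon>" "\<epsilon> \<le> 1" by auto
    have "1 \<le> \<epsilon> powr (- 1 / r)"
      using powr_mono2'[of "- 1 / r" \<epsilon> 1] \<epsilon> r by simp
    then have C: "R0 \<le> ?C * \<epsilon> powr (- 1 / r)"
      using R0 mult_mono[of R0 ?C 1 "\<epsilon> powr (- 1 / r)"] by simp
    show "lifespan \<alpha> \<beta> p u0 u1 \<epsilon> \<le> ennreal (?C * \<epsilon> powr (- 1 / r))"
    proof (rule lifespan_le)
      fix T u R
      assume sol: "is_solution \<alpha> \<beta> p \<epsilon> u0 u1 T u" and R: "?C * \<epsilon> powr (- 1 / r) < R" "ennreal R < T"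
      have RR: "R0 \<le> R" "R > 0" using C R R0 by linarith+
      have "\<epsilon> * d \<le> K * ((M + 1) * R powr (- r))"
        using main[OF sol \<epsilon>(1) RR(1) R(2)] mult_left_mono[OF le[OF RR(1)] less_imp_le[OF K]] by (rule order_trans)
      then have "\<epsilon> * d \<le> K' * R powr (- r)" by (simp add: K'_def mult.assoc)
      then have "R \<le> (K' / d) powr (1 / r) * \<epsilon> powr (- 1 / r)"
        by (rule powr_decay_imp_bound) (use r \<epsilon> d K' RR in auto)
      also have "\<dots> \<le> ?C * \<epsilon> powr (- 1 / r)" by (intro mult_right_mono) auto
      finally show False using R by simp
    qed (use C R0 in linarith)
  qed
  have part1: "\<exists>C>0. \<forall>\<epsilon>\<in>{0<..1}. lifespan \<alpha> \<beta> p u0 u1 \<epsilon> \<le> ennreal (C * \<epsilon> powr (- 1 / \<kappa>))"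
    if "1 + \<alpha> / (n - \<alpha>) < p"
  proof (rule decay[OF \<kappa>])
    fix R assume R: "R0 \<le> R"
    \<comment> \<open>Under the scaling both terms decay at the same rate in this regime.\<close>
    have "- (1 + \<beta>) / (p - 1) + s * (n - \<alpha> * q) = - \<kappa>"
    proof -
      have "1 + \<beta> = s * (2 - \<alpha>)" using assms(2) by (simp add: s_def)
      moreover have "- (2 - \<alpha>) / (p - 1) + (n - \<alpha> * q) = - (2 / (p - 1) - (n - \<alpha>))"
      proof -
        have "q = 1 + 1 / (p - 1)" using p1 by (simp add: q_def field_simps)
        then show ?thesis unfolding divide_inverse by (simp add: algebra_simps)
      qed
      ultimately show ?thesis
        unfolding \<kappa>_eq by (metis distrib_left minus_mult_right times_divide_eq_right)
    qed
    then have "R powr (- (1 + \<beta>) / (p - 1)) * (R powr s) powr (n - \<alpha> * q) = R powr (- \<kappa>)"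
      by (simp add: powr_powr powr_add[symmetric])
    moreover have "R powr (- (1 + \<beta>) / (p - 1)) * J (R powr s)
        \<le> R powr (- (1 + \<beta>) / (p - 1)) * (M * (R powr s) powr (n - \<alpha> * q))"
      using that crit by (intro mult_left_mono J1 Ls R) auto
    ultimately show "R powr (- (1 + \<beta>) / (p - 1)) * J (R powr s) + R powr (- \<kappa>) \<le> (M + 1) * R powr (- \<kappa>)"
      by (simp add: algebra_simps)
  qed
  have \<beta>0: "\<beta> = 0" if "\<alpha> > 0" using that assms(5) by simp
  \<comment> \<open>In the other two regimes the term with \<open>R powr (- \<kappa>)\<close> decays
    at least as fast as \<open>R powr (- (1 / (p - 1)))\<close>, so the term with \<open>J\<close>
    decides; \<open>\<beta> = 0\<close> holds there.\<close>
  have \<kappa>_ge: "1 / (p - 1) \<le> \<kappa>" if \<alpha>0: "\<alpha> > 0" and le: "p \<le> 1 + \<alpha> / (n - \<alpha>)"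
  proof -
    have "n - \<alpha> \<le> \<alpha> / (p - 1)"
      using le p1 n\<alpha> by (simp add: field_simps)
    then have "(2 - \<alpha>) / (p - 1) \<le> 2 / (p - 1) - (n - \<alpha>)"
      by (simp add: diff_divide_distrib)
    then have "s * ((2 - \<alpha>) / (p - 1)) \<le> \<kappa>"
      unfolding \<kappa>_eq using s by (intro mult_left_mono) auto
    then show ?thesis using \<beta>0[OF \<alpha>0] assms(2) by (simp add: s_def)
  qed
  have part3: "\<exists>C>0. \<forall>\<epsilon>\<in>{0<..1}. lifespan \<alpha> \<beta> p u0 u1 \<epsilon> \<le> ennreal (C * \<epsilon> powr (- (p - 1)))"
    if \<alpha>0: "\<alpha> > 0" and sub: "p < 1 + \<alpha> / (n - \<alpha>)"
  proof -
    have "\<exists>C>0. \<forall>\<epsilon>\<in>{0<..1}. lifespan \<alpha> \<beta> p u0 u1 \<epsilon> \<le> ennreal (C * \<epsilon> powr (- 1 / (1 / (p - 1))))"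
    proof (rule decay)
      show "1 / (p - 1) > 0" using p1 by simp
      fix R assume R: "R0 \<le> R"
      have "R powr (- (1 / (p - 1))) * J (R powr s) \<le> R powr (- (1 / (p - 1))) * M"
        using sub crit by (intro mult_left_mono J3 Ls R) auto
      moreover have "R powr (- \<kappa>) \<le> R powr (- (1 / (p - 1)))"
        using \<kappa>_ge[OF \<alpha>0] sub R R0 by (intro powr_mono) auto
      ultimately show "R powr (- (1 + \<beta>) / (p - 1)) * J (R powr s) + R powr (- \<kappa>)
          \<le> (M + 1) * R powr (- (1 / (p - 1)))"
        by (simp add: \<beta>0[OF \<alpha>0] algebra_simps)
    qed
    then show ?thesis by simp
  qed
  have part2: "\<exists>C>0. (\<forall>\<epsilon>\<in>{0<..\<epsilon>0}. lifespan \<alpha> \<beta> p u0 u1 \<epsilon>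
          \<le> ennreal (C * (\<epsilon> powr (- (p - 1)) * (ln (inverse \<epsilon>)) powr (p - 1))))
      \<and> (\<forall>\<epsilon>\<in>{\<epsilon>0<..1}. lifespan \<alpha> \<beta> p u0 u1 \<epsilon> \<le> ennreal C)"
    if \<alpha>0: "\<alpha> > 0" and crit_p: "p = 1 + \<alpha> / (n - \<alpha>)" and \<epsilon>0: "0 < \<epsilon>0" "\<epsilon>0 < 1" for \<epsilon>0
  proof -
    \<comment> \<open>The factor \<open>p\<close> comes from replacing \<open>ln R\<close> by
      \<open>(p - 1) * ln S\<close> with \<open>S = R powr (1 / (p - 1))\<close>: for
      \<open>S \<ge> 1\<close>, \<open>1 + ln R \<le> p * (1 + ln S)\<close>.\<close>
    define N where "N = K' * p / d"
    have N: "N > 0" using K' d assms(6) by (simp add: N_def)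
    have key: "\<epsilon> * R powr (1 / (p - 1)) \<le> N * (1 + ln (R powr (1 / (p - 1))))"
      if sol: "is_solution \<alpha> \<beta> p \<epsilon> u0 u1 T u" and \<epsilon>: "0 < \<epsilon>" and R: "R0 \<le> R" "ennreal R < T" for \<epsilon> T u R
    proof -
      define S where "S = R powr (1 / (p - 1))"
      have R1: "R \<ge> 1" using R R0 by simp
      then have lnR: "ln R \<ge> 0" and S: "S > 0" by (simp_all add: S_def)
      have lnRS: "ln R = (p - 1) * ln S" using R1 p1 by (simp add: S_def ln_powr)
      have Sinv: "R powr (- (1 / (p - 1))) = 1 / S" by (simp add: S_def powr_minus_divide)
      have "ln (R powr s) \<le> ln R" using R1 mult_right_mono[OF s(2) lnR] by (simp add: ln_powr)
      then have "J (R powr s) \<le> M * (1 + ln R)"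
        using J2[OF Ls[OF R(1)]] crit(2) crit_p M by (smt (verit) mult_left_mono)
      moreover have "R powr (- \<kappa>) \<le> 1 / S"
        unfolding Sinv[symmetric] using \<kappa>_ge[OF \<alpha>0] crit_p R1 by (intro powr_mono) auto
      ultimately have "R powr (- (1 + \<beta>) / (p - 1)) * J (R powr s) + R powr (- \<kappa>)
          \<le> 1 / S * (M * (1 + ln R)) + 1 / S"
        using S Sinv \<beta>0[OF \<alpha>0] by (intro add_mono) (simp_all add: divide_right_mono)
      also have "\<dots> \<le> (M + 1) * (1 + ln R) / S"
        using S lnR by (simp add: field_simps)
      also have "\<dots> \<le> (M + 1) * (p * (1 + ln S)) / S"
      proof -
        have "ln S \<ge> 0" using lnRS lnR p1 by (simp add: zero_le_mult_iff)
        then have "1 + ln R \<le> p * (1 + ln S)"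
          using lnRS assms(6) by (simp add: algebra_simps)
        then show ?thesis using M S by (intro divide_right_mono mult_left_mono) auto
      qed
      finally have "K * (R powr (- (1 + \<beta>) / (p - 1)) * J (R powr s) + R powr (- \<kappa>))
          \<le> K * ((M + 1) * (p * (1 + ln S)) / S)"
        using K by (intro mult_left_mono) auto
      with main[OF sol \<epsilon> R] have "\<epsilon> * d \<le> K * ((M + 1) * (p * (1 + ln S)) / S)"
        by (rule order_trans)
      then have "\<epsilon> * S \<le> N * (1 + ln S)"
        using S d by (simp add: N_def K'_def field_simps)
      then show ?thesis by (simp add: S_def)
    qed
    have R_eq: "R = (R powr (1 / (p - 1))) powr (p - 1)" if "R0 \<le> R" for R
      using that R0 p1 by (simp add: powr_powr)
    have S1: "1 \<le> R powr (1 / (p - 1))" if "R0 \<le> R" for R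
      using that R0 p1 by (intro ge_one_powr_ge_zero) auto
    \<comment> \<open>On \<open>{0<..\<epsilon>0}\<close> the logarithm stays above
      \<open>l0 > 0\<close>, so additive constants are bounded by multiples of it; this is how
      \<open>N2\<close> arises.\<close>
    define l0 where "l0 = ln (inverse \<epsilon>0)"
    have l0: "l0 > 0" using \<epsilon>0 by (simp add: l0_def ln_inverse)
    define N2 where "N2 = N * ((1 + 2 * \<bar>ln (2 * N)\<bar>) / l0 + 2)"
    have N2: "N2 > 0" unfolding N2_def using N l0 by (intro mult_pos_pos add_nonneg_pos) auto
    \<comment> \<open>The first pair serves \<open>\<epsilon> > \<epsilon>0\<close>: it ensures
      \<open>R0 \<le> R\<close> and dominates the crude bound of \<open>log_decay_imp_bound\<close>,
      which decreases in \<epsilon>. The second pair does the same for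
      \<open>\<epsilon> \<le> \<epsilon>0\<close> with the refined bound.\<close>
    define C where "C = max (max R0 (((2 * N / \<epsilon>0)\<^sup>2) powr (p - 1))) (max (R0 / l0 powr (p - 1)) (N2 powr (p - 1)))"
    have C: "C \<ge> R0" "C \<ge> ((2 * N / \<epsilon>0)\<^sup>2) powr (p - 1)" "C \<ge> R0 / l0 powr (p - 1)" "C \<ge> N2 powr (p - 1)"
      by (auto simp: C_def)
    have small: "lifespan \<alpha> \<beta> p u0 u1 \<epsilon> \<le> ennreal (C * (\<epsilon> powr (- (p - 1)) * (ln (inverse \<epsilon>)) powr (p - 1)))"
      if \<epsilon>: "0 < \<epsilon>" "\<epsilon> \<le> \<epsilon>0" for \<epsilon>
    proof (rule lifespan_le)
      define l where "l = ln (inverse \<epsilon>)"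
      have l: "l0 \<le> l" using \<epsilon> \<epsilon>0 by (simp add: l_def l0_def)
      have "1 \<le> \<epsilon> powr (- (p - 1))"
        using powr_mono2'[of "- (p - 1)" \<epsilon> 1] \<epsilon> \<epsilon>0 p1 by simp
      then have "1 * l0 powr (p - 1) \<le> \<epsilon> powr (- (p - 1)) * l powr (p - 1)"
        using l l0 p1 by (intro mult_mono powr_mono2) auto
      then have "R0 / l0 powr (p - 1) * l0 powr (p - 1) \<le> C * (\<epsilon> powr (- (p - 1)) * l powr (p - 1))"
        using C R0 by (intro mult_mono) auto
      then have b: "R0 \<le> C * (\<epsilon> powr (- (p - 1)) * l powr (p - 1))"
        using l0 by simp
      then show "0 \<le> C * (\<epsilon> powr (- (p - 1)) * (ln (inverse \<epsilon>)) powr (p - 1))"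
        using R0 by (simp add: l_def)
      fix T u R
      assume sol: "is_solution \<alpha> \<beta> p \<epsilon> u0 u1 T u" and RT: "ennreal R < T"
        and R: "C * (\<epsilon> powr (- (p - 1)) * (ln (inverse \<epsilon>)) powr (p - 1)) < R"
      have RR: "R0 \<le> R" using b R by (simp add: l_def)
      have "R powr (1 / (p - 1)) \<le> N * (1 + 2 * \<bar>ln (2 * N)\<bar> + 2 * l) / \<epsilon>"
        unfolding l_def by (rule log_decay_imp_bound(2)[OF key[OF sol \<epsilon>(1) RR RT] \<epsilon>(1) N S1[OF RR]])
      also have "1 + 2 * \<bar>ln (2 * N)\<bar> \<le> (1 + 2 * \<bar>ln (2 * N)\<bar>) / l0 * l"
        using l l0 mult_left_mono[OF l, of "(1 + 2 * \<bar>ln (2 * N)\<bar>) / l0"] by simp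
      then have "N * (1 + 2 * \<bar>ln (2 * N)\<bar> + 2 * l) / \<epsilon> \<le> N2 * l / \<epsilon>"
        unfolding N2_def mult.assoc using N \<epsilon> by (intro divide_right_mono mult_left_mono) (auto simp: distrib_right)
      finally have "(R powr (1 / (p - 1))) powr (p - 1) \<le> (N2 * l / \<epsilon>) powr (p - 1)"
        using p1 by (intro powr_mono2) auto
      also have "\<dots> = N2 powr (p - 1) * (\<epsilon> powr (- (p - 1)) * l powr (p - 1))"
        using N2 l l0 \<epsilon> by (simp add: powr_divide powr_mult powr_minus_divide del: minus_diff_eq)
      also have "\<dots> \<le> C * (\<epsilon> powr (- (p - 1)) * l powr (p - 1))"
        using C by (intro mult_right_mono) auto
      finally show False using R R_eq[OF RR] by (simp add: l_def)
    qed
    have large: "lifespan \<alpha> \<beta> p u0 u1 \<epsilon> \<le> ennreal C" if \<epsilon>: "\<epsilon>0 < \<epsilon>" for \<epsilon>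
    proof (rule lifespan_le)
      show "0 \<le> C" using C R0 by simp
      fix T u R
      assume sol: "is_solution \<alpha> \<beta> p \<epsilon> u0 u1 T u" and R: "C < R" and RT: "ennreal R < T"
      have RR: "R0 \<le> R" using C R by simp
      have \<epsilon>pos: "0 < \<epsilon>" using \<epsilon> \<epsilon>0 by simp
      have "R powr (1 / (p - 1)) \<le> (2 * N / \<epsilon>)\<^sup>2"
        by (rule log_decay_imp_bound(1)[OF key[OF sol \<epsilon>pos RR RT] \<epsilon>pos N S1[OF RR]])
      also have "\<dots> \<le> (2 * N / \<epsilon>0)\<^sup>2"
        using \<epsilon> \<epsilon>0 N by (intro power_mono divide_left_mono) auto
      finally have "(R powr (1 / (p - 1))) powr (p - 1) \<le> ((2 * N / \<epsilon>0)\<^sup>2) powr (p - 1)"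
        using p1 by (intro powr_mono2) auto
      with C R R_eq[OF RR] show False by simp
    qed
    show ?thesis
      using small large C R0 by (intro exI[of _ C] conjI ballI) auto
  qed
  show ?thesis
    using part1 part2 part3 unfolding n_def \<kappa>_def by auto
qed

end
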